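(* Let $\mathcal{G}=(V,E)$ be a finite connected undirected graph with conductances $c:E\to\mathbb{R}_{>0}$ and a marked vertex $b\in V$. Let $\Sigma$ be the floating component of a $\mathbb{P}$-random two-component spanning forest of $\mathcal{G}$, let $|\Sigma|$ be its number of vertices, and let $\ell^*=\mathbb{E}(|\partial\Sigma|)$. Then $$\mathbb{E}(|\Sigma|)=\ell^*\,\frac{|V|}{|V|-1}\,R\qquad\text{and}\qquad \mathbb{E}(|\Sigma|^2)=\ell^*\,\frac{|V|}{|V|-1}\,\mathbb{E}(\tau_b),$$ where $R=\sum_{v\in V}G_{v,v}/|V|$ is the mean resistance between $v$ and $b$ for a uniform random $v$, and $$\mathbb{E}(\tau_b)=\frac1{|V|}\sum_{u,v\in V}G_{u,v}$$ is the expected hitting time to $b$ for the conductance-biased random walk started at a uniform starting vertex.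
   Context: A two-component spanning forest (2SF) of $\mathcal{G}$ is a subgraph $(V,B)$, $B\subseteq E$, which contains no cycles and has exactly two connected components. The weight of a subgraph is the product of the conductances $c(e)$ of its edges. $\mathbb{P}$ (with expectation $\mathbb{E}$) is the probability measure on 2SFs assigning to each 2SF a probability proportional to its weight. The floating component of a 2SF is the component not containing $b$. $\partial\Sigma$ is the set of edges with exactly one endpoint in $\Sigma$, and $|\partial\Sigma|$ denotes the sum of the conductances of the edges in $\partial\Sigma$. One has $\ell^*=\kappa(|V|-1)/\kappa_2$, where $\kappa$ and $\kappa_2$ are the weighted sums of the spanning trees and of the 2SFs of $\mathcal{G}$, respectively. The Laplacian is $\Delta f(v)=\sum_{v'\sim v}c_{vv'}(f(v)-f(v'))$ on $\mathbb{R}^V$, the sum being over the neighbors of $v$. The Dirichlet Laplacian $\Delta_D$ on $\mathbb{R}^{V\setminus\{b\}}$ is the matrix obtained from $\Delta$ by removing the row and column of $b$; it is invertible. $G=\Delta_D^{-1}$ is the Green's function with Dirichlet boundary conditions at $b$ (so $G_{u,v}=0$ if $u=b$ or $v=b$). $G_{u,u}$ is the resistance between $u$ and $b$, and $G_{u,v}$ is interpreted as the expected number of visits to $v$ of a conductance-biased random walk from $u$ to $b$. The conductance-biased random walk is the walk which moves from a vertex to a neighbor with probability proportional to the conductance of the connecting edge.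
   Formalization: The hitting time is that of the continuous-time conductance walk (exponential holding time of mean 1/c(v) at v), since with unit time steps the formula for E(τ_b) fails, e.g. for a single edge of conductance 2; also |V| ≥ 2 is assumed so that two-component spanning forests exist. *)

theory Defs
  imports "HOL-Probability.Probability"
begin

text \<open>
  A simple undirected graph is a vertex set \<open>V\<close> with a set \<open>E\<close> of two-element subsets of \<open>V\<close>.
  Conductances are given by a function on edges; only its values on \<open>E\<close> matter.
\<close>

definition simple_graph :: "'a set \<Rightarrow> 'a set set \<Rightarrow> bool" where
  "simple_graph V E \<longleftrightarrow> (\<forall>e\<in>E. \<exists>u\<in>V. \<exists>v\<in>V. u \<noteq> v \<and> e = {u, v})"

definition reachability :: "'a set \<Rightarrow> 'a set set \<Rightarrow> ('a \<times> 'a) set" where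
  "reachability V B = {(u, v). u \<in> V \<and> v \<in> V \<and> (u, v) \<in> {(x, y). {x, y} \<in> B}\<^sup>*}"

definition connected_graph :: "'a set \<Rightarrow> 'a set set \<Rightarrow> bool" where
  "connected_graph V E \<longleftrightarrow> V \<noteq> {} \<and> (\<forall>u\<in>V. \<forall>v\<in>V. (u, v) \<in> reachability V E)"

definition graph_components :: "'a set \<Rightarrow> 'a set set \<Rightarrow> 'a set set" where
  "graph_components V B = V // reachability V B"

definition has_cycle :: "'a set set \<Rightarrow> bool" where
  "has_cycle B \<longleftrightarrow> (\<exists>xs. length xs \<ge> 3 \<and> distinct xs \<and>
     (\<forall>i < length xs. {xs ! i, xs ! (Suc i mod length xs)} \<in> B))"

text \<open>A two-component spanning forest \<open>(V, B)\<close> is represented by its edge set \<open>B\<close>.\<close>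

definition two_forests :: "'a set \<Rightarrow> 'a set set \<Rightarrow> 'a set set set" where
  "two_forests V E = {B. B \<subseteq> E \<and> \<not> has_cycle B \<and> card (graph_components V B) = 2}"

definition weight :: "('a set \<Rightarrow> real) \<Rightarrow> 'a set set \<Rightarrow> real" where
  "weight c B = (\<Prod>e\<in>B. c e)"

text \<open>
  The probabilities below sum to one as soon as \<open>V\<close> is finite, the conductances are positive and
  \<open>two_forests V E\<close> is nonempty; the last holds for connected graphs with at least two vertices.
\<close>

definition two_forest_pmf :: "'a set \<Rightarrow> 'a set set \<Rightarrow> ('a set \<Rightarrow> real) \<Rightarrow> 'a set set pmf" where
  "two_forest_pmf V E c = embed_pmf (\<lambda>B. if B \<in> two_forests V E
     then weight c B / (\<Sum>B'\<in>two_forests V E. weight c B') else 0)"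

definition floating_component :: "'a set \<Rightarrow> 'a \<Rightarrow> 'a set set \<Rightarrow> 'a set" where
  "floating_component V b B = (THE C. C \<in> graph_components V B \<and> b \<notin> C)"

definition edge_boundary :: "'a set set \<Rightarrow> 'a set \<Rightarrow> 'a set set" where
  "edge_boundary E S = {e \<in> E. card (e \<inter> S) = 1}"

definition boundary_size :: "'a set set \<Rightarrow> ('a set \<Rightarrow> real) \<Rightarrow> 'a set \<Rightarrow> real" where
  "boundary_size E c S = (\<Sum>e\<in>edge_boundary E S. c e)"

definition laplacian ::
    "'a set \<Rightarrow> 'a set set \<Rightarrow> ('a set \<Rightarrow> real) \<Rightarrow> ('a \<Rightarrow> real) \<Rightarrow> 'a \<Rightarrow> real" where
  "laplacian V E c f v = (\<Sum>v'\<in>{v'\<in>V. {v, v'} \<in> E}. c {v, v'} * (f v - f v'))"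

definition laplacian_matrix ::
    "'a set \<Rightarrow> 'a set set \<Rightarrow> ('a set \<Rightarrow> real) \<Rightarrow> 'a \<Rightarrow> 'a \<Rightarrow> real" where
  "laplacian_matrix V E c u v = laplacian V E c (\<lambda>x. of_bool (x = v)) u"

text \<open>
  The inverse of a square matrix with rows and columns indexed by a finite set \<open>S\<close>,
  extended by zero outside \<open>S\<close>.
\<close>

definition matrix_inverse_on :: "'a set \<Rightarrow> ('a \<Rightarrow> 'a \<Rightarrow> real) \<Rightarrow> 'a \<Rightarrow> 'a \<Rightarrow> real" where
  "matrix_inverse_on S A = (THE B.
     (\<forall>u\<in>S. \<forall>v\<in>S. (\<Sum>w\<in>S. A u w * B w v) = of_bool (u = v)) \<and>
     (\<forall>u\<in>S. \<forall>v\<in>S. (\<Sum>w\<in>S. B u w * A w v) = of_bool (u = v)) \<and>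
     (\<forall>u v. u \<notin> S \<or> v \<notin> S \<longrightarrow> B u v = 0))"

text \<open>
  Restricting the index set to \<open>V - {b}\<close> removes the row and the column of \<open>b\<close>, so the matrix
  inverted here is the Dirichlet Laplacian.
\<close>

definition green ::
    "'a set \<Rightarrow> 'a set set \<Rightarrow> ('a set \<Rightarrow> real) \<Rightarrow> 'a \<Rightarrow> 'a \<Rightarrow> 'a \<Rightarrow> real" where
  "green V E c b = matrix_inverse_on (V - {b}) (laplacian_matrix V E c)"

text \<open>
  Effective resistance: the potential difference when a unit current enters the network at \<open>u\<close>
  and leaves it at \<open>v\<close>.
\<close>

definition resistance ::
    "'a set \<Rightarrow> 'a set set \<Rightarrow> ('a set \<Rightarrow> real) \<Rightarrow> 'a \<Rightarrow> 'a \<Rightarrow> real" where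
  "resistance V E c u v = (THE r. \<exists>f.
     (\<forall>x\<in>V. laplacian V E c f x = of_bool (x = u) - of_bool (x = v)) \<and> r = f u - f v)"

definition vertex_conductance ::
    "'a set \<Rightarrow> 'a set set \<Rightarrow> ('a set \<Rightarrow> real) \<Rightarrow> 'a \<Rightarrow> real" where
  "vertex_conductance V E c v = (\<Sum>v'\<in>{v'\<in>V. {v, v'} \<in> E}. c {v, v'})"

definition transition_prob ::
    "'a set \<Rightarrow> 'a set set \<Rightarrow> ('a set \<Rightarrow> real) \<Rightarrow> 'a \<Rightarrow> 'a \<Rightarrow> real" where
  "transition_prob V E c u v =
     (if {u, v} \<in> E then c {u, v} / vertex_conductance V E c u else 0)"

text \<open>
  The conductance-biased walk in continuous time, with generator the negative Laplacian, given by
  its jump chain \<open>X\<close>, started from the uniform distribution on \<open>V\<close>, and independent standard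
  exponential clocks \<open>H\<close>: the walk stays at its \<open>n\<close>-th vertex \<open>X n\<close> for the time
  \<open>H n / vertex_conductance (X n)\<close> and then moves to a neighbour with probability proportional
  to the conductance of the connecting edge.
  With unit time steps instead, the expected number of visits would be the Green's function
  multiplied by the vertex conductance, rather than the Green's function itself.
\<close>

definition conductance_walk ::
    "'a set \<Rightarrow> 'a set set \<Rightarrow> ('a set \<Rightarrow> real) \<Rightarrow> 'w measure \<Rightarrow>
     (nat \<Rightarrow> 'w \<Rightarrow> 'a) \<Rightarrow> (nat \<Rightarrow> 'w \<Rightarrow> real) \<Rightarrow> bool" where
  "conductance_walk V E c M X H \<longleftrightarrow>
     prob_space M \<and>
     (\<forall>n. X n \<in> M \<rightarrow>\<^sub>M count_space V) \<and>
     (\<forall>n x. (\<forall>i\<le>n. x i \<in> V) \<longrightarrow>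
        measure M {\<omega> \<in> space M. \<forall>i\<le>n. X i \<omega> = x i} =
        (1 / real (card V)) * (\<Prod>i<n. transition_prob V E c (x i) (x (Suc i)))) \<and>
     prob_space.indep_vars M (\<lambda>_. borel) H UNIV \<and>
     (\<forall>n. distributed M lborel (H n) (exponential_density 1)) \<and>
     prob_space.indep_set M
       (sets (vimage_algebra (space M) (\<lambda>\<omega> n. X n \<omega>) (\<Pi>\<^sub>M n\<in>UNIV. count_space V)))
       (sets (vimage_algebra (space M) (\<lambda>\<omega> n. H n \<omega>) (\<Pi>\<^sub>M n\<in>UNIV. borel)))"

text \<open>
  The time of the \<open>n\<close>-th jump is the sum of the first \<open>n\<close> holding times; the hitting time of \<open>b\<close> is
  the least time at which the walk arrives at \<open>b\<close>, and \<open>\<infinity>\<close> if it never does.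
\<close>

definition hitting_time ::
    "'a set \<Rightarrow> 'a set set \<Rightarrow> ('a set \<Rightarrow> real) \<Rightarrow> 'a \<Rightarrow>
     (nat \<Rightarrow> 'w \<Rightarrow> 'a) \<Rightarrow> (nat \<Rightarrow> 'w \<Rightarrow> real) \<Rightarrow> 'w \<Rightarrow> ennreal" where
  "hitting_time V E c b X H \<omega> = (INF n\<in>{n. X n \<omega> = b}.
     ennreal (\<Sum>k<n. H k \<omega> / vertex_conductance V E c (X k \<omega>)))"

end

theory Submission
  imports Defs
begin

text \<open>
  Both moment formulas say that the Green's function is a ratio of forest and tree sums,
  \[ G_{u,v} = \frac{1}{\kappa} \sum_B w(B) 1[u, v \in \Sigma_B], \]
  where \<open>B\<close> ranges over the two-component spanning forests, \<open>\<Sigma>\<^sub>B\<close> is the floating component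
  and \<open>\<kappa>\<close> is the weighted number of spanning trees. Summing over \<open>u = v\<close>, respectively over all
  pairs \<open>u, v\<close>, produces \<open>|\<Sigma>\<^sub>B|\<close> and \<open>|\<Sigma>\<^sub>B|\<^sup>2\<close> on the right-hand side.

  No determinants are involved. Everything rests on one bijection
  (\<open>sum_forest_boundary_eq_sum_tree_edges\<close>): a forest \<open>B\<close> together with an edge \<open>e\<close> in the boundary
  of \<open>\<Sigma>\<^sub>B\<close> is the same as a spanning tree \<open>T = B + e\<close> together with one of its edges, and
  \<open>w(B) c(e) = w(T)\<close>. Counting the \<open>|V| - 1\<close> edges of a tree yields
  \<open>\<ell>\<^sup>* = \<kappa> (|V| - 1) / \<kappa>\<^sub>2\<close>. Applied to the Laplacian of the forest sum in \<open>u\<close>, which only involves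
  the boundary edges at \<open>u\<close>, the bijection turns \<open>\<Delta>\<^sub>D G = 1\<close> into a statement about each single
  tree: the unit current from \<open>v\<close> to \<open>b\<close> in a tree has outflow one at \<open>v\<close> and zero at every other
  vertex except \<open>b\<close> (\<open>tree_current_outflow\<close>). As the forest sum and the Laplacian are symmetric, it
  is a two-sided inverse, which determines \<open>G\<close> and shows that the Dirichlet problem has unique
  solutions, so that \<open>G\<^sub>v\<^sub>,\<^sub>v\<close> is the resistance between \<open>v\<close> and \<open>b\<close>.

  For the walk, \<open>h(u) = \<Sum>\<^sub>v G\<^sub>u\<^sub>,\<^sub>v\<close> solves \<open>\<Delta> h = 1\<close> off \<open>b\<close> and \<open>h(b) = 0\<close>. This is the first-step
  equation \<open>h(u) = 1 / c(u) + \<Sum>\<^sub>v p(u, v) h(v)\<close>, in which \<open>1 / c(u)\<close> is the mean holding time at \<open>u\<close>.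
  Iterating it along the walk killed at \<open>b\<close> telescopes the expected time spent before hitting
  \<open>b\<close>. The total is finite, which forces the survival probability to \<open>0\<close>; hence \<open>b\<close> is hit almost
  surely and the remainder of the telescoping sum vanishes.
\<close>

section \<open>Cycles and connected components\<close>

definition adjacency :: "'a set set \<Rightarrow> ('a \<times> 'a) set" where
  "adjacency B = {(x, y). {x, y} \<in> B}"

lemma sym_rtrancl_adjacency: "sym ((adjacency B)\<^sup>*)"
  by (intro sym_rtrancl symI) (auto simp: adjacency_def insert_commute)

lemma rtrancl_adjacency_commute: "(x, y) \<in> (adjacency B)\<^sup>* \<longleftrightarrow> (y, x) \<in> (adjacency B)\<^sup>*"
  using sym_rtrancl_adjacency[of B] by (auto dest: symD)

lemma adjacency_edge: "{x, y} \<in> B \<Longrightarrow> (x, y) \<in> (adjacency B)\<^sup>*"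
  by (auto simp: adjacency_def)

lemma rtrancl_adjacency_insert:
  "(u, v) \<in> (adjacency (insert {x, y} B))\<^sup>* \<longleftrightarrow>
     (u, v) \<in> (adjacency B)\<^sup>* \<or>
     (u, x) \<in> (adjacency B)\<^sup>* \<and> (y, v) \<in> (adjacency B)\<^sup>* \<or>
     (u, y) \<in> (adjacency B)\<^sup>* \<and> (x, v) \<in> (adjacency B)\<^sup>*"
proof -
  have "adjacency (insert {x, y} B) = insert (x, y) (insert (y, x) (adjacency B))"
    by (auto simp: adjacency_def doubleton_eq_iff)
  then show ?thesis
    by (auto simp: rtrancl_insert intro: rtrancl_trans)
qed

lemma reachability_iff:
  "(u, v) \<in> reachability V B \<longleftrightarrow> u \<in> V \<and> v \<in> V \<and> (u, v) \<in> (adjacency B)\<^sup>*"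
  by (simp add: reachability_def adjacency_def)

lemma graph_components_eq:
  "graph_components V B = (\<lambda>v. {w \<in> V. (v, w) \<in> (adjacency B)\<^sup>*}) ` V"
  by (auto simp: graph_components_def quotient_def reachability_iff)

lemma rtrancl_imp_distinct_path:
  assumes "(x, y) \<in> r\<^sup>*"
  shows "\<exists>xs. xs \<noteq> [] \<and> hd xs = x \<and> last xs = y \<and> distinct xs \<and>
           successively (\<lambda>a b. (a, b) \<in> r) xs"
  using assms
proof (induction rule: converse_rtrancl_induct)
  case base
  show ?case by (intro exI[of _ "[y]"]) simp
next
  case (step x z)
  then obtain xs where xs: "xs \<noteq> []" "hd xs = z" "last xs = y" "distinct xs"
    "successively (\<lambda>a b. (a, b) \<in> r) xs" by blast
  show ?case
  proof (cases "x \<in> set xs")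
    case True
    then obtain ys zs where "xs = ys @ x # zs" by (meson split_list)
    with xs show ?thesis
      by (intro exI[of _ "x # zs"]) (auto simp: successively_append_iff)
  next
    case False
    with xs step.hyps show ?thesis
      by (intro exI[of _ "x # xs"]) (auto simp: successively_Cons)
  qed
qed

lemma has_cycle_mono: "has_cycle B \<Longrightarrow> B \<subseteq> B' \<Longrightarrow> has_cycle B'"
  unfolding has_cycle_def by blast

text \<open>
  A simple path between the ends of the new edge closes up to a cycle; conversely a cycle that
  passes through the new edge, opened at that edge, is a path between its ends. The bound
  \<open>length xs \<ge> 3\<close> guarantees that a cycle passes through each of its edges only once.
\<close>

lemma has_cycle_insert_iff:
  assumes acyclic: "\<not> has_cycle B" and "x \<noteq> y" and new: "{x, y} \<notin> B"
  shows "has_cycle (insert {x, y} B) \<longleftrightarrow> (x, y) \<in> (adjacency B)\<^sup>*"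
proof
  assume "(x, y) \<in> (adjacency B)\<^sup>*"
  then obtain xs where xs: "xs \<noteq> []" "hd xs = x" "last xs = y" "distinct xs"
    and succ: "successively (\<lambda>a b. (a, b) \<in> adjacency B) xs"
    using rtrancl_imp_distinct_path by metis
  have "length xs \<ge> 3"
  proof (rule ccontr)
    assume "\<not> length xs \<ge> 3"
    moreover obtain a as where as: "xs = a # as" using xs(1) by (cases xs) auto
    ultimately consider "as = []" | d where "as = [d]"
      by (cases as; cases "tl as") auto
    then show False
      by cases (use xs as succ assms in \<open>auto simp: adjacency_def\<close>)
  qed
  moreover have "{xs ! i, xs ! (Suc i mod length xs)} \<in> insert {x, y} B" if "i < length xs" for i
  proof (cases "Suc i < length xs")
    case True
    then show ?thesis using succ by (auto simp: successively_conv_nth adjacency_def)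
  next
    case False
    with that have "Suc i = length xs" by simp
    then have "xs ! i = y" "xs ! (Suc i mod length xs) = x"
      using xs by (auto simp: last_conv_nth hd_conv_nth simp flip: \<open>Suc i = length xs\<close>)
    then show ?thesis by auto
  qed
  ultimately show "has_cycle (insert {x, y} B)"
    unfolding has_cycle_def using xs(4) by blast
next
  assume "has_cycle (insert {x, y} B)"
  then obtain xs where xs: "length xs \<ge> 3" "distinct xs"
    and cyc: "\<And>i. i < length xs \<Longrightarrow> {xs ! i, xs ! (Suc i mod length xs)} \<in> insert {x, y} B"
    unfolding has_cycle_def by blast
  define n where "n = length xs"
  have n: "n \<ge> 3" using xs n_def by simp
  obtain i where i: "i < n" "{xs ! i, xs ! (Suc i mod n)} = {x, y}"
    using acyclic xs cyc unfolding has_cycle_def n_def by (metis insert_iff)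
  define ys where "ys = rotate (Suc i) xs"
  have ys: "length ys = n" "distinct ys" using xs by (auto simp: ys_def n_def)
  have nth: "ys ! j = xs ! ((Suc i + j) mod n)" if "j < n" for j
    using that by (simp add: ys_def nth_rotate n_def del: rotate_Suc)
  have ends: "ys ! (n - 1) = xs ! i" "ys ! 0 = xs ! (Suc i mod n)"
    using nth[of "n - 1"] nth[of 0] i n by auto
  have step: "{ys ! j, ys ! Suc j} \<in> B" if "Suc j < n" for j
  proof -
    have "(Suc i + j) mod n < n" using n by (intro mod_less_divisor) simp
    then have "{ys ! j, ys ! Suc j} \<in> insert {x, y} B"
      using cyc[of "(Suc i + j) mod n"] nth[of j] nth[of "Suc j"] that
      by (simp add: n_def mod_Suc_eq)
    moreover have "{ys ! j, ys ! Suc j} \<noteq> {ys ! (n - 1), ys ! 0}"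
      using that n ys by (auto simp: doubleton_eq_iff nth_eq_iff_index_eq)
    ultimately show ?thesis using i ends by auto
  qed
  have "(ys ! 0, ys ! j) \<in> (adjacency B)\<^sup>*" if "j < n" for j
    using that
  proof (induction j)
    case (Suc j)
    then show ?case using adjacency_edge[OF step[of j]] by (auto intro: rtrancl_trans)
  qed simp
  from this[of "n - 1"] show "(x, y) \<in> (adjacency B)\<^sup>*"
    using n i ends rtrancl_adjacency_commute[of x y B] by (auto simp: doubleton_eq_iff)
qed

text \<open>
  The classes of \<open>x\<close> and \<open>y\<close> merge and all others persist. The set \<open>U\<close> in the proof
  consists of the vertices of the other classes.
\<close>

lemma card_graph_components_insert:
  assumes "finite V" "x \<in> V" "y \<in> V" and sep: "(x, y) \<notin> (adjacency B)\<^sup>*"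
  shows "card (graph_components V B) = Suc (card (graph_components V (insert {x, y} B)))"
proof -
  let ?C = "\<lambda>B v. {w \<in> V. (v, w) \<in> (adjacency B)\<^sup>*}"
  let ?B = "insert {x, y} B"
  define U where "U = {v \<in> V. (v, x) \<notin> (adjacency B)\<^sup>* \<and> (v, y) \<notin> (adjacency B)\<^sup>*}"
  note sym = rtrancl_adjacency_commute[of _ _ B]
  have tr: "(p, r) \<in> (adjacency B)\<^sup>*"
    if "(p, q) \<in> (adjacency B)\<^sup>*" "(q, r) \<in> (adjacency B)\<^sup>*" for p q r
    using that by (rule rtrancl_trans)
  have classes: "?C B v \<in> {?C B x, ?C B y}" if "v \<in> V" "v \<notin> U" for v
  proof -
    have "(v, x) \<in> (adjacency B)\<^sup>* \<or> (v, y) \<in> (adjacency B)\<^sup>*" using that by (auto simp: U_def)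
    then show ?thesis
    proof
      assume "(v, x) \<in> (adjacency B)\<^sup>*"
      then have "?C B v = ?C B x" using sym tr by blast
      then show ?thesis by simp
    next
      assume "(v, y) \<in> (adjacency B)\<^sup>*"
      then have "?C B v = ?C B y" using sym tr by blast
      then show ?thesis by simp
    qed
  qed
  have old: "graph_components V B = insert (?C B x) (insert (?C B y) (?C B ` U))"
    unfolding graph_components_eq using classes assms by (auto simp: U_def)
  have U: "?C ?B v = ?C B v" if "v \<in> U" for v
    using that unfolding rtrancl_adjacency_insert by (auto simp: U_def)
  have merged: "?C ?B v = ?C B x \<union> ?C B y" if "v \<in> V" "v \<notin> U" for v
  proof -
    have "(v, w) \<in> (adjacency ?B)\<^sup>* \<longleftrightarrow>
        (x, w) \<in> (adjacency B)\<^sup>* \<or> (y, w) \<in> (adjacency B)\<^sup>*" for w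
    proof -
      have "(v, x) \<in> (adjacency B)\<^sup>* \<or> (v, y) \<in> (adjacency B)\<^sup>*"
        using that by (simp add: U_def)
      then show ?thesis
        unfolding rtrancl_adjacency_insert by (metis sym tr)
    qed
    then show ?thesis by blast
  qed
  have "x \<notin> U" "y \<notin> U" by (auto simp: U_def)
  have "V = U \<union> (V - U)" by (auto simp: U_def)
  then have "graph_components V ?B = ?C ?B ` U \<union> ?C ?B ` (V - U)"
    unfolding graph_components_eq by (metis image_Un)
  also have "?C ?B ` U = ?C B ` U" using U by (intro image_cong) auto
  also have "?C ?B ` (V - U) = (\<lambda>v. ?C B x \<union> ?C B y) ` (V - U)"
    using merged by (intro image_cong) auto
  also have "\<dots> = {?C B x \<union> ?C B y}"
    using \<open>x \<in> V\<close> \<open>x \<notin> U\<close> by auto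
  finally have new: "graph_components V ?B = insert (?C B x \<union> ?C B y) (?C B ` U)" by simp
  have notU: "S \<notin> ?C B ` U" if "x \<in> S \<or> y \<in> S" for S
    using that by (auto simp: U_def)
  have "x \<in> ?C B x" "y \<in> ?C B y" using assms by auto
  moreover have "?C B x \<noteq> ?C B y"
    using assms by (metis (mono_tags, lifting) mem_Collect_eq rtrancl.rtrancl_refl)
  ultimately show ?thesis
    unfolding old new using notU[of "?C B x"] notU[of "?C B y"] notU[of "?C B x \<union> ?C B y"]
      \<open>finite V\<close> by (simp add: U_def)
qed

locale finite_simple_graph =
  fixes V :: "'a set" and E :: "'a set set"
  assumes finite_V: "finite V" and simple: "simple_graph V E"
begin

lemma edgeE:
  assumes "e \<in> E"
  obtains x y where "x \<in> V" "y \<in> V" "x \<noteq> y" "e = {x, y}"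
  using simple assms unfolding simple_graph_def by blast

lemma finite_E: "finite E"
  using finite_V by (rule finite_subset[rotated, OF finite_Pow_iff[THEN iffD2]]) (auto elim!: edgeE)

text \<open>
  Each edge of a forest, added to an acyclic set of the others, joins two components.
\<close>

lemma card_forest:
  assumes "B \<subseteq> E" "\<not> has_cycle B"
  shows "card B + card (graph_components V B) = card V"
proof -
  have "finite B" using assms finite_E finite_subset by blast
  then show ?thesis using assms
  proof (induction B rule: finite_induct)
    case empty
    have "(adjacency {})\<^sup>* = (Id :: ('a \<times> 'a) set)" by (auto simp: adjacency_def)
    then have "graph_components V {} = (\<lambda>v. {v}) ` V"
      unfolding graph_components_eq by (auto simp: image_iff)
    then show ?case by (simp add: card_image)
  next
    case (insert e F)
    then have F: "\<not> has_cycle F" using has_cycle_mono by (meson subset_insertI)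
    obtain x y where xy: "x \<in> V" "y \<in> V" "x \<noteq> y" "e = {x, y}"
      using insert.prems edgeE by blast
    have "(x, y) \<notin> (adjacency F)\<^sup>*"
      using has_cycle_insert_iff[OF F, of x y] xy insert by auto
    from card_graph_components_insert[OF finite_V xy(1,2) this]
    show ?case using insert F xy by simp
  qed
qed

lemma card_graph_components_one_iff:
  "card (graph_components V B) = 1 \<longleftrightarrow>
     V \<noteq> {} \<and> (\<forall>x\<in>V. \<forall>y\<in>V. (x, y) \<in> (adjacency B)\<^sup>*)"
proof
  assume "card (graph_components V B) = 1"
  then obtain K where "graph_components V B = {K}" by (rule card_1_singletonE)
  then have K: "{w \<in> V. (v, w) \<in> (adjacency B)\<^sup>*} = K" if "v \<in> V" for v
  proof -
    have "{w \<in> V. (v, w) \<in> (adjacency B)\<^sup>*} \<in> graph_components V B"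
      using that unfolding graph_components_eq by (rule imageI)
    then show ?thesis using \<open>graph_components V B = {K}\<close> by simp
  qed
  have "V \<noteq> {}" using \<open>graph_components V B = {K}\<close> unfolding graph_components_eq by auto
  moreover have "(x, y) \<in> (adjacency B)\<^sup>*" if "x \<in> V" "y \<in> V" for x y
    using K[of x] K[of y] that by blast
  ultimately show "V \<noteq> {} \<and> (\<forall>x\<in>V. \<forall>y\<in>V. (x, y) \<in> (adjacency B)\<^sup>*)" by blast
next
  assume "V \<noteq> {} \<and> (\<forall>x\<in>V. \<forall>y\<in>V. (x, y) \<in> (adjacency B)\<^sup>*)"
  then have "graph_components V B = {V}" unfolding graph_components_eq by auto
  then show "card (graph_components V B) = 1" by simp
qed

end

section \<open>Cutting spanning trees and joining two-component forests\<close>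

definition spanning_trees :: "'a set \<Rightarrow> 'a set set \<Rightarrow> 'a set set set" where
  "spanning_trees V E = {T. T \<subseteq> E \<and> \<not> has_cycle T \<and> card (graph_components V T) = 1}"

lemma edge_boundary_doubleton_iff:
  assumes "{x, y} \<in> E" "x \<noteq> y"
  shows "{x, y} \<in> edge_boundary E S \<longleftrightarrow> (x \<in> S \<longleftrightarrow> y \<notin> S)"
  using assms by (cases "x \<in> S"; cases "y \<in> S") (auto simp: edge_boundary_def)

locale network = finite_simple_graph V E
  for V :: "'a set" and E :: "'a set set" +
  fixes c :: "'a set \<Rightarrow> real" and b :: 'a
  assumes connected: "connected_graph V E"
    and c_pos: "\<And>e. e \<in> E \<Longrightarrow> c e > 0"
    and b_in: "b \<in> V"
    and card_V: "card V \<ge> 2"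
begin

abbreviation "floating \<equiv> floating_component V b"

lemma two_components:
  assumes "card (graph_components V B) = 2"
  shows floating_eq: "floating B = {v \<in> V. (v, b) \<notin> (adjacency B)\<^sup>*}"
    and floating_linked: "\<And>u v. u \<in> floating B \<Longrightarrow> v \<in> floating B \<Longrightarrow> (u, v) \<in> (adjacency B)\<^sup>*"
proof -
  let ?C = "\<lambda>v. {w \<in> V. (v, w) \<in> (adjacency B)\<^sup>*}"
  let ?S = "{v \<in> V. (v, b) \<notin> (adjacency B)\<^sup>*}"
  have comps: "graph_components V B = ?C ` V" by (rule graph_components_eq)
  have "\<exists>v\<in>V. ?C v \<noteq> ?C b"
  proof (rule ccontr)
    assume "\<not> ?thesis"
    then have "?C ` V \<subseteq> {?C b}" by blast
    then have "card (?C ` V) \<le> 1"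
      using card_mono[of "{?C b}" "?C ` V"] by simp
    then show False using assms comps by simp
  qed
  then obtain v where v: "v \<in> V" "?C v \<noteq> ?C b" by blast
  have "{?C v, ?C b} \<subseteq> ?C ` V" using v b_in by blast
  moreover have "card (?C ` V) = card {?C v, ?C b}" using v assms comps by simp
  ultimately have two: "?C ` V = {?C v, ?C b}"
    using card_subset_eq[of "?C ` V" "{?C v, ?C b}"] finite_V by simp
  have eq: "?C w = ?C v" if "w \<in> ?S" for w
  proof -
    have "?C w \<in> ?C ` V" using that by blast
    moreover have "b \<in> ?C b" "b \<notin> ?C w" using that b_in by auto
    then have "?C w \<noteq> ?C b" by blast
    ultimately show ?thesis using two by simp
  qed
  have "(v, b) \<notin> (adjacency B)\<^sup>*"
  proof
    assume vb: "(v, b) \<in> (adjacency B)\<^sup>*"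
    then have "(b, v) \<in> (adjacency B)\<^sup>*" by (simp add: rtrancl_adjacency_commute)
    with vb have "?C v = ?C b" by (auto intro: rtrancl_trans)
    with v show False by simp
  qed
  then have "b \<notin> ?C v" by simp
  have "?C v = ?S"
  proof
    show "?S \<subseteq> ?C v" using eq by blast
    show "?C v \<subseteq> ?S"
      using \<open>(v, b) \<notin> (adjacency B)\<^sup>*\<close> by (auto intro: rtrancl_trans)
  qed
  have "floating B = ?C v"
    unfolding floating_component_def comps two
    by (rule the_equality) (use \<open>b \<notin> ?C v\<close> b_in in auto)
  with \<open>?C v = ?S\<close> show S: "floating B = ?S" by simp
  show "(u, w) \<in> (adjacency B)\<^sup>*" if "u \<in> floating B" "w \<in> floating B" for u w
    using eq[of u] eq[of w] that unfolding S by blast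
qed

lemma two_forestsD:
  assumes "B \<in> two_forests V E"
  shows "B \<subseteq> E" "\<not> has_cycle B" "card (graph_components V B) = 2"
  using assms by (auto simp: two_forests_def)

lemma floating_subset: "B \<in> two_forests V E \<Longrightarrow> floating B \<subseteq> V"
  using floating_eq two_forestsD(3) by blast

lemma floating_cong:
  assumes "B \<in> two_forests V E" "u \<in> V" "v \<in> V" "(u, v) \<in> (adjacency B)\<^sup>*"
  shows "u \<in> floating B \<longleftrightarrow> v \<in> floating B"
  using assms(2-) rtrancl_trans[OF assms(4), of b]
    rtrancl_trans[OF assms(4)[THEN rtrancl_adjacency_commute[THEN iffD1]], of b]
  unfolding floating_eq[OF two_forestsD(3)[OF assms(1)]] by blast

lemma b_notin_floating: "B \<in> two_forests V E \<Longrightarrow> b \<notin> floating B"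
  using floating_eq two_forestsD(3) by auto

text \<open>
  In a tree every edge is a bridge, so that removing one creates exactly one more component.
\<close>

lemma cut_spanning_tree:
  assumes T: "T \<in> spanning_trees V E" and "e \<in> T"
  shows "T - {e} \<in> two_forests V E"
    and "e \<in> edge_boundary E (floating (T - {e}))"
proof -
  have "T \<subseteq> E" "\<not> has_cycle T" and one: "card (graph_components V T) = 1"
    using T by (auto simp: spanning_trees_def)
  obtain x y where xy: "x \<in> V" "y \<in> V" "x \<noteq> y" "e = {x, y}"
    using edgeE \<open>e \<in> T\<close> \<open>T \<subseteq> E\<close> by blast
  have T_eq: "insert {x, y} (T - {e}) = T" using \<open>e \<in> T\<close> xy by auto
  have acyclic: "\<not> has_cycle (T - {e})"
    using \<open>\<not> has_cycle T\<close> has_cycle_mono by blast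
  have sep: "(x, y) \<notin> (adjacency (T - {e}))\<^sup>*"
    using has_cycle_insert_iff[OF acyclic \<open>x \<noteq> y\<close>] \<open>\<not> has_cycle T\<close> T_eq xy by simp
  have two: "card (graph_components V (T - {e})) = 2"
    using card_graph_components_insert[OF finite_V xy(1,2) sep] T_eq one by simp
  then show forest: "T - {e} \<in> two_forests V E"
    using \<open>T \<subseteq> E\<close> acyclic by (auto simp: two_forests_def)
  have "x \<in> floating (T - {e}) \<longleftrightarrow> y \<notin> floating (T - {e})"
  proof -
    have "\<not> (x \<in> floating (T - {e}) \<and> y \<in> floating (T - {e}))"
      using floating_linked[OF two] sep by blast
    moreover have "x \<in> floating (T - {e}) \<or> y \<in> floating (T - {e})"
      using sep xy rtrancl_trans[of x b _ y] rtrancl_adjacency_commute[of y b]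
      unfolding floating_eq[OF two] by blast
    ultimately show ?thesis by blast
  qed
  then show "e \<in> edge_boundary E (floating (T - {e}))"
    using edge_boundary_doubleton_iff[of x y E] xy \<open>e \<in> T\<close> \<open>T \<subseteq> E\<close> by auto
qed

lemma join_two_forest:
  assumes B: "B \<in> two_forests V E" and e: "e \<in> edge_boundary E (floating B)"
  shows "e \<notin> B" and "insert e B \<in> spanning_trees V E"
proof -
  have "e \<in> E" using e by (simp add: edge_boundary_def)
  then obtain x y where xy: "x \<in> V" "y \<in> V" "x \<noteq> y" "e = {x, y}"
    using edgeE by blast
  have "x \<in> floating B \<longleftrightarrow> y \<notin> floating B"
    using e \<open>e \<in> E\<close> xy edge_boundary_doubleton_iff by metis
  then have sep: "(x, y) \<notin> (adjacency B)\<^sup>*"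
    using floating_cong[OF B xy(1,2)] by blast
  then show "e \<notin> B" using adjacency_edge xy by metis
  then have "\<not> has_cycle (insert e B)"
    using has_cycle_insert_iff[OF two_forestsD(2)[OF B] xy(3)] sep xy by simp
  moreover have "card (graph_components V (insert e B)) = 1"
    using card_graph_components_insert[OF finite_V xy(1,2) sep] two_forestsD(3)[OF B] xy by simp
  ultimately show "insert e B \<in> spanning_trees V E"
    using \<open>e \<in> E\<close> two_forestsD(1)[OF B] by (auto simp: spanning_trees_def)
qed

lemma finite_spanning_trees: "finite (spanning_trees V E)"
  by (rule finite_subset[of _ "Pow E"]) (auto simp: spanning_trees_def finite_E)

lemma finite_two_forests: "finite (two_forests V E)"
  by (rule finite_subset[of _ "Pow E"]) (auto simp: two_forests_def finite_E)

lemma spanning_tree_linked: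
  assumes "T \<in> spanning_trees V E" "u \<in> V" "v \<in> V"
  shows "(u, v) \<in> (adjacency T)\<^sup>*"
  using assms unfolding spanning_trees_def card_graph_components_one_iff by blast

lemma card_spanning_tree: "T \<in> spanning_trees V E \<Longrightarrow> card T = card V - 1"
  using card_forest[of T] by (auto simp: spanning_trees_def)

text \<open>A maximal acyclic edge set of a connected graph is a spanning tree.\<close>

lemma spanning_trees_nonempty: "spanning_trees V E \<noteq> {}"
proof -
  let ?A = "{B. B \<subseteq> E \<and> \<not> has_cycle B}"
  have "finite ?A" using finite_E by (auto intro: finite_subset[of _ "Pow E"])
  moreover have "{} \<in> ?A" by (auto simp: has_cycle_def intro!: exI[of _ 0])
  then have "?A \<noteq> {}" by (metis empty_iff)
  ultimately have "\<exists>T\<in>?A. \<forall>B\<in>?A. T \<subseteq> B \<longrightarrow> T = B" by (rule finite_has_maximal)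
  then obtain T where T: "T \<in> ?A" and max: "\<And>B. B \<in> ?A \<Longrightarrow> T \<subseteq> B \<Longrightarrow> T = B"
    by (elim bexE) simp
  have "(x, y) \<in> (adjacency T)\<^sup>*" if "{x, y} \<in> E" for x y
  proof (rule ccontr)
    assume sep: "(x, y) \<notin> (adjacency T)\<^sup>*"
    then have "x \<noteq> y" "{x, y} \<notin> T" using adjacency_edge[of x y T] by auto
    then have "insert {x, y} T \<in> ?A"
      using has_cycle_insert_iff[of T x y] sep T that by auto
    with max[of "insert {x, y} T"] \<open>{x, y} \<notin> T\<close> show False by blast
  qed
  then have "adjacency E \<subseteq> (adjacency T)\<^sup>*" by (auto simp: adjacency_def)
  then have "(adjacency E)\<^sup>* \<subseteq> (adjacency T)\<^sup>*" by (rule rtrancl_subset_rtrancl)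
  then have "card (graph_components V T) = 1"
    using connected unfolding card_graph_components_one_iff connected_graph_def
    by (auto simp: reachability_iff)
  then show ?thesis using T by (auto simp: spanning_trees_def)
qed

lemma two_forests_nonempty: "two_forests V E \<noteq> {}"
proof -
  obtain T where T: "T \<in> spanning_trees V E" using spanning_trees_nonempty by blast
  have "T \<noteq> {}" using card_spanning_tree[OF T] card_V by auto
  then show ?thesis using cut_spanning_tree(1)[OF T] by blast
qed

definition tree_sum :: real where
  "tree_sum = (\<Sum>T\<in>spanning_trees V E. weight c T)"

definition forest_sum :: real where
  "forest_sum = (\<Sum>B\<in>two_forests V E. weight c B)"

lemma weight_pos: "B \<subseteq> E \<Longrightarrow> weight c B > 0"
  using c_pos by (auto simp: weight_def intro!: prod_pos)

lemma tree_sum_pos: "tree_sum > 0"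
  unfolding tree_sum_def
  by (intro sum_pos finite_spanning_trees spanning_trees_nonempty weight_pos)
    (auto simp: spanning_trees_def)

lemma forest_sum_pos: "forest_sum > 0"
  unfolding forest_sum_def
  by (intro sum_pos finite_two_forests two_forests_nonempty weight_pos) (auto simp: two_forests_def)

text \<open>
  Adding the edge to the forest and cutting it out of the tree are mutually inverse between
  the pairs of a two-component forest with an edge in the boundary of its floating component
  and the pairs of a spanning tree with one of its edges.
\<close>

lemma sum_forest_boundary_eq_sum_tree_edges:
  "(\<Sum>B\<in>two_forests V E. weight c B * (\<Sum>e\<in>edge_boundary E (floating B). c e * \<phi> B e)) =
   (\<Sum>T\<in>spanning_trees V E. weight c T * (\<Sum>e\<in>T. \<phi> (T - {e}) e))"
proof -
  have fin: "finite B" if "B \<subseteq> E" for B using that finite_E finite_subset by blast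
  have "(\<Sum>B\<in>two_forests V E. weight c B * (\<Sum>e\<in>edge_boundary E (floating B). c e * \<phi> B e)) =
      (\<Sum>(B, e)\<in>Sigma (two_forests V E) (\<lambda>B. edge_boundary E (floating B)).
        weight c B * c e * \<phi> B e)"
    using finite_two_forests finite_E
    by (subst sum.Sigma[symmetric]) (auto simp: sum_distrib_left mult.assoc edge_boundary_def)
  also have "\<dots> = (\<Sum>(T, e)\<in>Sigma (spanning_trees V E) (\<lambda>T. T). weight c T * \<phi> (T - {e}) e)"
  proof (rule sum.reindex_bij_witness[of _ "\<lambda>(T, e). (T - {e}, e)" "\<lambda>(B, e). (insert e B, e)"])
    fix p assume "p \<in> Sigma (two_forests V E) (\<lambda>B. edge_boundary E (floating B))"
    then obtain B e where p: "p = (B, e)" and B: "B \<in> two_forests V E"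
      and e: "e \<in> edge_boundary E (floating B)" by blast
    note j = join_two_forest[OF B e]
    show "(case case p of (B, e) \<Rightarrow> (insert e B, e) of (T, e) \<Rightarrow> (T - {e}, e)) = p"
      using j p by simp
    show "(case p of (B, e) \<Rightarrow> (insert e B, e)) \<in> Sigma (spanning_trees V E) (\<lambda>T. T)"
      using j p by simp
    have "weight c (insert e B) = c e * weight c B"
      using j fin[OF two_forestsD(1)[OF B]] by (simp add: weight_def)
    then show "(case case p of (B, e) \<Rightarrow> (insert e B, e) of
        (T, e) \<Rightarrow> weight c T * \<phi> (T - {e}) e) = (case p of (B, e) \<Rightarrow> weight c B * c e * \<phi> B e)"
      using j p by simp
  next
    fix p assume "p \<in> Sigma (spanning_trees V E) (\<lambda>T. T)"
    then obtain T e where p: "p = (T, e)" and T: "T \<in> spanning_trees V E" and e: "e \<in> T"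
      by blast
    show "(case case p of (T, e) \<Rightarrow> (T - {e}, e) of (B, e) \<Rightarrow> (insert e B, e)) = p"
      using p e by auto
    show "(case p of (T, e) \<Rightarrow> (T - {e}, e)) \<in>
        Sigma (two_forests V E) (\<lambda>B. edge_boundary E (floating B))"
      using p cut_spanning_tree[OF T e] by simp
  qed
  also have "\<dots> = (\<Sum>T\<in>spanning_trees V E. weight c T * (\<Sum>e\<in>T. \<phi> (T - {e}) e))"
    using finite_spanning_trees fin
    by (subst sum.Sigma[symmetric]) (auto simp: sum_distrib_left spanning_trees_def)
  finally show ?thesis .
qed

lemma sum_weight_boundary_size:
  "(\<Sum>B\<in>two_forests V E. weight c B * boundary_size E c (floating B)) =
     tree_sum * (real (card V) - 1)"
proof -
  have "real (card T) = real (card V) - 1" if "T \<in> spanning_trees V E" for T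
    using card_spanning_tree[OF that] card_V by simp
  then show ?thesis
    using sum_forest_boundary_eq_sum_tree_edges[of "\<lambda>_ _. 1"]
    by (simp add: boundary_size_def tree_sum_def sum_distrib_right)
qed

section \<open>The Green's function as a sum over forests\<close>

text \<open>
  Only the edges at \<open>u\<close> that leave \<open>S\<close> contribute. The sum is nevertheless written over the whole
  boundary, with an indicator for \<open>u\<close>, so that its range does not depend on \<open>u\<close> when \<open>S\<close> is the
  floating component of a varying forest.
\<close>

lemma laplacian_of_bool:
  "laplacian V E c (\<lambda>x. of_bool (x \<in> S)) u =
    (\<Sum>e\<in>edge_boundary E S. c e * (of_bool (u \<in> e) * (if u \<in> S then 1 else - 1)))"
proof -
  let ?N = "{u' \<in> V. {u, u'} \<in> E}"
  let ?g = "\<lambda>e. if e \<in> edge_boundary E S then c e * (if u \<in> S then 1 else - 1) else 0"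
  have neq: "u' \<noteq> u" if "{u, u'} \<in> E" for u'
    using that edgeE[OF that] by (auto simp: doubleton_eq_iff)
  have img: "(\<lambda>u'. {u, u'}) ` ?N = {e \<in> E. u \<in> e}"
  proof
    show "{e \<in> E. u \<in> e} \<subseteq> (\<lambda>u'. {u, u'}) ` ?N"
    proof
      fix e assume e: "e \<in> {e \<in> E. u \<in> e}"
      then obtain x y where xy: "x \<in> V" "y \<in> V" "e = {x, y}" using edgeE by blast
      define u' where "u' = (if u = x then y else x)"
      have "e = {u, u'}" "u' \<in> V" using xy e by (auto simp: u'_def)
      then show "e \<in> (\<lambda>u'. {u, u'}) ` ?N" using e by simp
    qed
  qed auto
  have "laplacian V E c (\<lambda>x. of_bool (x \<in> S)) u = (\<Sum>u'\<in>?N. ?g {u, u'})"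
    unfolding laplacian_def
  proof (intro sum.cong refl)
    fix u' assume "u' \<in> ?N"
    then have "{u, u'} \<in> E" by simp
    note neq[OF this, symmetric] and edge_boundary_doubleton_iff[OF this neq[OF this, symmetric], of S]
    then show "c {u, u'} * (of_bool (u \<in> S) - of_bool (u' \<in> S)) = ?g {u, u'}"
      by (cases "u \<in> S"; cases "u' \<in> S") simp_all
  qed
  also have "\<dots> = (\<Sum>e\<in>{e \<in> E. u \<in> e}. ?g e)"
    unfolding img[symmetric]
    by (subst sum.reindex) (auto simp: inj_on_def doubleton_eq_iff)
  also have "\<dots> = (\<Sum>e\<in>edge_boundary E S. c e * (of_bool (u \<in> e) * (if u \<in> S then 1 else - 1)))"
    using finite_E by (intro sum.mono_neutral_cong) (auto simp: edge_boundary_def)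
  finally show ?thesis .
qed

text \<open>
  A unit current from \<open>v\<close> to \<open>b\<close> in a tree has net outflow one at \<open>v\<close> and none at any other
  \<open>u \<noteq> b\<close>. The edge \<open>e\<close> carries the current exactly if cutting it separates \<open>v\<close> from \<open>b\<close>, and
  then away from the side of \<open>v\<close>. When \<open>v\<close> moves along an edge \<open>e\<^sub>0\<close>, only the term of \<open>e\<^sub>0\<close>
  changes, so that the net outflow minus \<open>of_bool (u = v)\<close> does not depend on \<open>v\<close>; it vanishes
  at \<open>v = b\<close>.
\<close>

lemma tree_current_outflow:
  assumes T: "T \<in> spanning_trees V E" and u: "u \<in> V" "u \<noteq> b" and v: "v \<in> V"
  shows "(\<Sum>e\<in>T. of_bool (v \<in> floating (T - {e})) *
      (of_bool (u \<in> e) * (if u \<in> floating (T - {e}) then 1 else - 1))) = (of_bool (u = v) :: real)"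
proof -
  define \<phi> :: "'a \<Rightarrow> 'a set \<Rightarrow> real" where
    "\<phi> v e = of_bool (v \<in> floating (T - {e})) *
      (of_bool (u \<in> e) * (if u \<in> floating (T - {e}) then 1 else - 1))" for v e
  have "T \<subseteq> E" using T by (simp add: spanning_trees_def)
  then have "finite T" using finite_E finite_subset by blast
  have step: "(\<Sum>e\<in>T. \<phi> x e) - of_bool (u = x) = (\<Sum>e\<in>T. \<phi> y e) - of_bool (u = y)"
    if xy: "{x, y} \<in> T" for x y
  proof -
    let ?e = "{x, y}"
    have "x \<noteq> y" "x \<in> V" "y \<in> V" using xy \<open>T \<subseteq> E\<close> by (auto elim!: edgeE simp: doubleton_eq_iff)
    have same: "\<phi> x e = \<phi> y e" if "e \<in> T - {?e}" for e
    proof -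
      have "(x, y) \<in> (adjacency (T - {e}))\<^sup>*" using that xy by (intro adjacency_edge) auto
      then have "x \<in> floating (T - {e}) \<longleftrightarrow> y \<in> floating (T - {e})"
        using that cut_spanning_tree(1)[OF T] \<open>x \<in> V\<close> \<open>y \<in> V\<close> floating_cong by blast
      then show ?thesis by (simp add: \<phi>_def)
    qed
    have "?e \<in> edge_boundary E (floating (T - {?e}))" by (rule cut_spanning_tree[OF T xy])
    then have "x \<in> floating (T - {?e}) \<longleftrightarrow> y \<notin> floating (T - {?e})"
      using edge_boundary_doubleton_iff[of x y E "floating (T - {?e})"] \<open>x \<noteq> y\<close> xy \<open>T \<subseteq> E\<close>
      by auto
    then have "\<phi> x ?e - \<phi> y ?e = of_bool (u = x) - of_bool (u = y)"
      using \<open>x \<noteq> y\<close> by (auto simp: \<phi>_def)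
    then show ?thesis
      using sum.remove[OF \<open>finite T\<close> xy, of "\<phi> x"] sum.remove[OF \<open>finite T\<close> xy, of "\<phi> y"]
        sum.cong[OF refl same, of "T - {?e}"] by simp
  qed
  have "(v, b) \<in> (adjacency T)\<^sup>*" using spanning_tree_linked[OF T v b_in] .
  then have "(\<Sum>e\<in>T. \<phi> v e) - of_bool (u = v) = (\<Sum>e\<in>T. \<phi> b e) - of_bool (u = b)"
    by (induction rule: converse_rtrancl_induct) (use step in \<open>auto simp: adjacency_def\<close>)
  also have "(\<Sum>e\<in>T. \<phi> b e) = 0"
    using cut_spanning_tree(1)[OF T] b_notin_floating by (intro sum.neutral) (auto simp: \<phi>_def)
  finally show ?thesis using u unfolding \<phi>_def by simp
qed

text \<open>
  The cofactors of the Dirichlet Laplacian over its determinant, in the form given by the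
  all-minors matrix-tree theorem.
\<close>

definition forest_green :: "'a \<Rightarrow> 'a \<Rightarrow> real" where
  "forest_green u v =
     (\<Sum>B\<in>two_forests V E. weight c B * of_bool (v \<in> floating B) * of_bool (u \<in> floating B)) / tree_sum"

lemma forest_green_sym: "forest_green u v = forest_green v u"
  by (simp add: forest_green_def mult_ac)

lemma forest_green_nonneg: "forest_green u v \<ge> 0"
  unfolding forest_green_def using tree_sum_pos weight_pos[OF two_forestsD(1)]
  by (intro divide_nonneg_pos sum_nonneg mult_nonneg_nonneg) (auto intro: less_imp_le)

lemma forest_green_eq_0: "u \<notin> V - {b} \<or> v \<notin> V - {b} \<Longrightarrow> forest_green u v = 0"
proof -
  assume "u \<notin> V - {b} \<or> v \<notin> V - {b}"
  then have "weight c B * of_bool (v \<in> floating B) * of_bool (u \<in> floating B) = 0"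
    if "B \<in> two_forests V E" for B
    using b_notin_floating[OF that] floating_subset[OF that] by auto
  then have "(\<Sum>B\<in>two_forests V E.
      weight c B * of_bool (v \<in> floating B) * of_bool (u \<in> floating B)) = 0"
    by (intro sum.neutral ballI)
  then show ?thesis by (simp add: forest_green_def)
qed

lemma laplacian_sum:
  "laplacian V E c (\<lambda>x. \<Sum>i\<in>I. a i * f i x) u = (\<Sum>i\<in>I. a i * laplacian V E c (f i) u)"
  unfolding laplacian_def sum_distrib_left
  by (subst sum.swap) (simp add: sum_subtractf[symmetric] sum_distrib_left algebra_simps)

lemma laplacian_forest_green:
  assumes u: "u \<in> V" "u \<noteq> b" and v: "v \<in> V"
  shows "laplacian V E c (\<lambda>x. forest_green x v) u = of_bool (u = v)"
proof -
  let ?\<phi> = "\<lambda>B e. of_bool (v \<in> floating B) * (of_bool (u \<in> e) * (if u \<in> floating B then 1 else - 1))"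
  have "laplacian V E c (\<lambda>x. forest_green x v) u =
      laplacian V E c (\<lambda>x. \<Sum>B\<in>two_forests V E.
        (weight c B * of_bool (v \<in> floating B) / tree_sum) * of_bool (x \<in> floating B)) u"
    by (simp add: forest_green_def sum_divide_distrib)
  also have "\<dots> = (\<Sum>B\<in>two_forests V E. weight c B *
      (\<Sum>e\<in>edge_boundary E (floating B). c e * ?\<phi> B e)) / tree_sum"
    unfolding laplacian_sum laplacian_of_bool
    by (simp add: sum_divide_distrib sum_distrib_left mult_ac)
  also have "\<dots> = (\<Sum>T\<in>spanning_trees V E. weight c T * of_bool (u = v)) / tree_sum"
    unfolding sum_forest_boundary_eq_sum_tree_edges using tree_current_outflow[OF _ u v] by simp
  also have "\<dots> = of_bool (u = v)"
    using tree_sum_pos by (simp add: tree_sum_def flip: sum_distrib_right)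
  finally show ?thesis .
qed

lemma laplacian_matrix_sum:
  assumes "u \<in> V" and f: "\<And>x. x \<in> V - S \<Longrightarrow> f x = 0" and "S \<subseteq> V"
  shows "(\<Sum>w\<in>S. laplacian_matrix V E c u w * f w) = laplacian V E c f u"
proof -
  have "finite S" using assms finite_V finite_subset by blast
  have "laplacian V E c f u = laplacian V E c (\<lambda>x. \<Sum>w\<in>S. f w * of_bool (x = w)) u"
    unfolding laplacian_def
  proof (intro sum.cong refl)
    have *: "f x = (\<Sum>w\<in>S. f w * of_bool (x = w))" if "x \<in> V" for x
      using that f[of x] \<open>finite S\<close> by (auto simp: sum.delta of_bool_def if_distrib cong: if_cong)
    fix v' assume "v' \<in> {v' \<in> V. {u, v'} \<in> E}"
    then show "c {u, v'} * (f u - f v') = c {u, v'} *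
        ((\<Sum>w\<in>S. f w * of_bool (u = w)) - (\<Sum>w\<in>S. f w * of_bool (v' = w)))"
      using *[of u] *[of v'] \<open>u \<in> V\<close> by simp
  qed
  also have "\<dots> = (\<Sum>w\<in>S. f w * laplacian_matrix V E c u w)"
    unfolding laplacian_sum laplacian_matrix_def ..
  finally show ?thesis by (simp add: mult.commute)
qed

lemma laplacian_matrix_sym: "laplacian_matrix V E c u w = laplacian_matrix V E c w u"
  if "u \<in> V" "w \<in> V"
proof (cases "u = w")
  case False
  have "laplacian_matrix V E c u w = (if {u, w} \<in> E then - c {u, w} else 0)"
    if "u \<in> V" "w \<in> V" "u \<noteq> w" for u w
  proof -
    have "laplacian_matrix V E c u w =
        (\<Sum>v'\<in>{v' \<in> V. {u, v'} \<in> E}. if v' = w then - c {u, w} else 0)"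
      unfolding laplacian_matrix_def laplacian_def using that by (intro sum.cong) auto
    also have "\<dots> = (if {u, w} \<in> E then - c {u, w} else 0)"
      using that finite_V by (subst sum.delta) auto
    finally show ?thesis .
  qed
  from this[of u w] this[of w u] that False show ?thesis by (simp add: insert_commute)
qed simp

lemma forest_green_right_inverse:
  assumes "u \<in> V - {b}" "v \<in> V - {b}"
  shows "(\<Sum>w\<in>V - {b}. laplacian_matrix V E c u w * forest_green w v) = of_bool (u = v)"
proof -
  have "(\<Sum>w\<in>V - {b}. laplacian_matrix V E c u w * forest_green w v) =
      laplacian V E c (\<lambda>w. forest_green w v) u"
    using assms by (intro laplacian_matrix_sum) (auto simp: forest_green_eq_0)
  then show ?thesis using assms by (simp add: laplacian_forest_green)
qed

lemma forest_green_left_inverse: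
  assumes "u \<in> V - {b}" "v \<in> V - {b}"
  shows "(\<Sum>w\<in>V - {b}. forest_green u w * laplacian_matrix V E c w v) = of_bool (u = v)"
proof -
  have "(\<Sum>w\<in>V - {b}. forest_green u w * laplacian_matrix V E c w v) =
      (\<Sum>w\<in>V - {b}. laplacian_matrix V E c v w * forest_green w u)"
    using assms by (intro sum.cong)
      (auto simp: mult.commute forest_green_sym[of u] laplacian_matrix_sym[of _ v])
  also have "\<dots> = of_bool (u = v)"
    using forest_green_right_inverse[OF assms(2,1)] by (simp add: eq_commute)
  finally show ?thesis .
qed

text \<open>
  The left inverse property in terms of functions. It yields uniqueness twice: for the inverse
  matrix and for the potential of a unit current.
\<close>

lemma forest_green_represent:
  assumes "u \<in> V - {b}" and f: "f b = 0"
  shows "f u = (\<Sum>w\<in>V - {b}. forest_green u w * laplacian V E c f w)"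
proof -
  let ?S = "V - {b}"
  have "finite ?S" using finite_V by simp
  have "(\<Sum>w\<in>?S. forest_green u w * laplacian V E c f w) =
      (\<Sum>w\<in>?S. forest_green u w * (\<Sum>v\<in>?S. laplacian_matrix V E c w v * f v))"
    using f by (intro sum.cong refl) (subst laplacian_matrix_sum, auto)
  also have "\<dots> = (\<Sum>v\<in>?S. (\<Sum>w\<in>?S. forest_green u w * laplacian_matrix V E c w v) * f v)"
    unfolding sum_distrib_left sum_distrib_right by (subst sum.swap) (simp add: mult.assoc)
  also have "\<dots> = (\<Sum>v\<in>?S. of_bool (u = v) * f v)"
    using forest_green_left_inverse assms by (intro sum.cong) auto
  also have "\<dots> = f u"
    using assms \<open>finite ?S\<close> by (simp add: of_bool_def if_distrib[of "\<lambda>x. x * _"] cong: if_cong)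
  finally show ?thesis ..
qed

lemma green_eq_forest_green: "green V E c b = forest_green"
  unfolding green_def matrix_inverse_on_def
proof (rule the_equality)
  let ?S = "V - {b}"
  show "(\<forall>u\<in>?S. \<forall>v\<in>?S. (\<Sum>w\<in>?S. laplacian_matrix V E c u w * forest_green w v) = of_bool (u = v)) \<and>
    (\<forall>u\<in>?S. \<forall>v\<in>?S. (\<Sum>w\<in>?S. forest_green u w * laplacian_matrix V E c w v) = of_bool (u = v)) \<and>
    (\<forall>u v. u \<notin> ?S \<or> v \<notin> ?S \<longrightarrow> forest_green u v = 0)"
    using forest_green_right_inverse forest_green_left_inverse forest_green_eq_0 by blast
next
  let ?S = "V - {b}"
  fix A :: "'a \<Rightarrow> 'a \<Rightarrow> real"
  assume A: "(\<forall>u\<in>?S. \<forall>v\<in>?S. (\<Sum>w\<in>?S. laplacian_matrix V E c u w * A w v) = of_bool (u = v)) \<and>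
    (\<forall>u\<in>?S. \<forall>v\<in>?S. (\<Sum>w\<in>?S. A u w * laplacian_matrix V E c w v) = of_bool (u = v)) \<and>
    (\<forall>u v. u \<notin> ?S \<or> v \<notin> ?S \<longrightarrow> A u v = 0)"
  have "A u v = forest_green u v" if "u \<in> ?S" "v \<in> ?S" for u v
  proof -
    have "A u v = (\<Sum>w\<in>?S. forest_green u w * laplacian V E c (\<lambda>x. A x v) w)"
      using A that by (intro forest_green_represent) auto
    also have "\<dots> = (\<Sum>w\<in>?S. forest_green u w * of_bool (w = v))"
    proof (intro sum.cong refl)
      fix w assume "w \<in> ?S"
      then have "laplacian V E c (\<lambda>x. A x v) w = of_bool (w = v)"
        using A that laplacian_matrix_sum[of w ?S "\<lambda>x. A x v"] by auto
      then show "forest_green u w * laplacian V E c (\<lambda>x. A x v) w = forest_green u w * of_bool (w = v)"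
        by simp
    qed
    also have "\<dots> = forest_green u v"
      using that finite_V by (simp add: of_bool_def if_distrib cong: if_cong)
    finally show ?thesis .
  qed
  then show "A = forest_green"
    using A forest_green_eq_0 by (intro ext) metis
qed

text \<open>
  Each edge contributes once with either sign. Hence the Laplacian of \<open>forest_green x v\<close> in \<open>x\<close>,
  known off \<open>b\<close>, is determined at \<open>b\<close> as well, and is that of a unit current from \<open>v\<close> to \<open>b\<close>.
\<close>

lemma sum_laplacian: "(\<Sum>u\<in>V. laplacian V E c f u) = 0"
proof -
  let ?s = "\<Sum>(u, v)\<in>Sigma V (\<lambda>u. {v \<in> V. {u, v} \<in> E}). c {u, v} * (f u - f v)"
  have "(\<Sum>u\<in>V. laplacian V E c f u) = ?s"
    unfolding laplacian_def using finite_V by (subst sum.Sigma) auto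
  moreover have "?s = - ?s"
    unfolding sum_negf[symmetric]
    by (rule sum.reindex_bij_witness[of _ prod.swap prod.swap])
      (auto simp: insert_commute algebra_simps)
  ultimately show ?thesis by linarith
qed

lemma resistance_eq_green:
  assumes v: "v \<in> V"
  shows "resistance V E c v b = green V E c b v v"
  unfolding green_eq_forest_green resistance_def
proof (rule the_equality)
  let ?g = "\<lambda>x. forest_green x v"
  have "?g b = 0" by (simp add: forest_green_eq_0)
  have "laplacian V E c ?g b = - (\<Sum>x\<in>V - {b}. laplacian V E c ?g x)"
    using sum_laplacian[of ?g] sum.remove[OF finite_V b_in, of "laplacian V E c ?g"] by simp
  also have "(\<Sum>x\<in>V - {b}. laplacian V E c ?g x) = (\<Sum>x\<in>V - {b}. of_bool (x = v))"
    using laplacian_forest_green v by (intro sum.cong) auto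
  also have "\<dots> = of_bool (v \<noteq> b)"
    using v finite_V by (simp add: of_bool_def if_distrib cong: if_cong)
  finally have "laplacian V E c ?g x = of_bool (x = v) - of_bool (x = b)" if "x \<in> V" for x
    using that v laplacian_forest_green[of x v] by (cases "x = b") auto
  then have g: "\<forall>x\<in>V. laplacian V E c ?g x = of_bool (x = v) - of_bool (x = b)" by blast
  with \<open>?g b = 0\<close> show "\<exists>f. (\<forall>x\<in>V. laplacian V E c f x = of_bool (x = v) - of_bool (x = b)) \<and>
      forest_green v v = f v - f b"
    by (intro exI[of _ ?g]) simp
  fix r assume "\<exists>f. (\<forall>x\<in>V. laplacian V E c f x = of_bool (x = v) - of_bool (x = b)) \<and> r = f v - f b"
  then obtain f where f: "\<forall>x\<in>V. laplacian V E c f x = of_bool (x = v) - of_bool (x = b)"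
    and r: "r = f v - f b" by blast
  show "r = forest_green v v"
  proof (cases "v = b")
    case True
    then show ?thesis using r \<open>?g b = 0\<close> by simp
  next
    case False
    \<comment> \<open>A potential is determined up to a constant; the one vanishing at \<open>b\<close> is represented by its
      Laplacian.\<close>
    let ?h = "\<lambda>x. f x - f b"
    have lap: "laplacian V E c ?h = laplacian V E c f" by (simp add: laplacian_def fun_eq_iff)
    have "r = (\<Sum>w\<in>V - {b}. forest_green v w * laplacian V E c ?h w)"
      using forest_green_represent[of v ?h] v False r by simp
    also have "\<dots> = (\<Sum>w\<in>V - {b}. forest_green v w * laplacian V E c ?g w)"
      using f g by (intro sum.cong) (auto simp: lap)
    also have "\<dots> = forest_green v v"
      using forest_green_represent[of v ?g] v False \<open>?g b = 0\<close> by simp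
    finally show ?thesis .
  qed
qed

section \<open>Moments of the floating component\<close>

lemma expectation_two_forest_pmf:
  "measure_pmf.expectation (two_forest_pmf V E c) (f :: _ \<Rightarrow> real) =
     (\<Sum>B\<in>two_forests V E. weight c B * f B) / forest_sum"
proof -
  let ?p = "\<lambda>B. if B \<in> two_forests V E then weight c B / forest_sum else 0"
  have nn: "?p B \<ge> 0" for B
    using forest_sum_pos weight_pos[OF two_forestsD(1)] by (auto intro: less_imp_le)
  have "(\<integral>\<^sup>+ B. ennreal (?p B) \<partial>count_space UNIV) = (\<Sum>B\<in>two_forests V E. ennreal (?p B))"
    by (rule nn_integral_count_space'[OF finite_two_forests]) auto
  also have "\<dots> = ennreal (\<Sum>B\<in>two_forests V E. ?p B)"
    using nn by (intro sum_ennreal)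
  also have "(\<Sum>B\<in>two_forests V E. ?p B) = 1"
    using forest_sum_pos by (simp add: forest_sum_def flip: sum_divide_distrib)
  finally have "(\<integral>\<^sup>+ B. ennreal (?p B) \<partial>count_space UNIV) = 1" by simp
  then have pmf: "pmf (two_forest_pmf V E c) B = ?p B" for B
    unfolding two_forest_pmf_def forest_sum_def[symmetric] using nn by (intro pmf_embed_pmf)
  have "measure_pmf.expectation (two_forest_pmf V E c) f =
      (\<Sum>B\<in>two_forests V E. f B * pmf (two_forest_pmf V E c) B)"
    by (rule integral_measure_pmf_real[OF finite_two_forests])
      (auto simp: set_pmf_iff pmf split: if_splits)
  then show ?thesis by (simp add: pmf sum_divide_distrib mult.commute)
qed

lemma expectation_boundary_size:
  "measure_pmf.expectation (two_forest_pmf V E c) (\<lambda>B. boundary_size E c (floating B)) =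
     tree_sum * (real (card V) - 1) / forest_sum"
  unfolding expectation_two_forest_pmf sum_weight_boundary_size ..

lemma card_floating:
  "real (card (floating B)) = (\<Sum>v\<in>V. of_bool (v \<in> floating B))" if "B \<in> two_forests V E"
  using finite_V floating_subset[OF that]
  by (simp add: of_bool_def sum.If_cases Int_absorb1)

lemma sum_green_diagonal:
  "(\<Sum>v\<in>V. green V E c b v v) =
     (\<Sum>B\<in>two_forests V E. weight c B * real (card (floating B))) / tree_sum"
proof -
  have "(\<Sum>v\<in>V. green V E c b v v) =
      (\<Sum>B\<in>two_forests V E. weight c B * (\<Sum>v\<in>V. of_bool (v \<in> floating B))) / tree_sum"
    unfolding green_eq_forest_green forest_green_def sum_divide_distrib[symmetric]
    by (subst sum.swap) (simp add: sum_distrib_left mult.assoc of_bool_conj[symmetric])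
  then show ?thesis by (simp add: card_floating cong: sum.cong)
qed

lemma sum_green:
  "(\<Sum>u\<in>V. \<Sum>v\<in>V. green V E c b u v) =
     (\<Sum>B\<in>two_forests V E. weight c B * (real (card (floating B)))\<^sup>2) / tree_sum"
proof -
  let ?t = "\<lambda>u v B. weight c B * of_bool (v \<in> floating B) * of_bool (u \<in> floating B)"
  have "(\<Sum>u\<in>V. \<Sum>v\<in>V. \<Sum>B\<in>two_forests V E. ?t u v B) =
      (\<Sum>u\<in>V. \<Sum>B\<in>two_forests V E. \<Sum>v\<in>V. ?t u v B)"
    by (intro sum.cong refl sum.swap)
  also have "\<dots> = (\<Sum>B\<in>two_forests V E. \<Sum>u\<in>V. \<Sum>v\<in>V. ?t u v B)"
    by (rule sum.swap)
  also have "\<dots> = (\<Sum>B\<in>two_forests V E. weight c B *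
      ((\<Sum>u\<in>V. of_bool (u \<in> floating B)) * (\<Sum>v\<in>V. of_bool (v \<in> floating B))))"
    unfolding sum_product by (simp add: sum_distrib_left mult_ac)
  also have "\<dots> = (\<Sum>B\<in>two_forests V E. weight c B * (real (card (floating B)))\<^sup>2)"
    by (intro sum.cong refl) (simp add: card_floating power2_eq_square)
  finally show ?thesis
    by (simp add: green_eq_forest_green forest_green_def flip: sum_divide_distrib)
qed

end

section \<open>The hitting time of the walk\<close>

context network
begin

abbreviation "conductance_at \<equiv> vertex_conductance V E c"
abbreviation "transition \<equiv> transition_prob V E c"

text \<open>
  The row sums of the Green's function. That they are hitting times rests on the first-step
  equation that they satisfy.
\<close>

definition mean_hitting_time :: "'a \<Rightarrow> real" where
  "mean_hitting_time u = (\<Sum>v\<in>V. green V E c b u v)"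

lemma mean_hitting_time_nonneg: "mean_hitting_time u \<ge> 0"
  unfolding mean_hitting_time_def green_eq_forest_green
  by (intro sum_nonneg forest_green_nonneg)

lemma mean_hitting_time_b: "mean_hitting_time b = 0"
  by (simp add: mean_hitting_time_def green_eq_forest_green forest_green_eq_0)

lemma laplacian_mean_hitting_time:
  assumes "u \<in> V - {b}"
  shows "laplacian V E c mean_hitting_time u = 1"
proof -
  have "laplacian V E c mean_hitting_time u =
      (\<Sum>v\<in>V. laplacian V E c (\<lambda>x. forest_green x v) u)"
    using laplacian_sum[of "\<lambda>_. 1" "\<lambda>v x. forest_green x v" V u]
    by (simp add: mean_hitting_time_def[abs_def] green_eq_forest_green)
  also have "\<dots> = (\<Sum>v\<in>V. of_bool (u = v))"
    using assms laplacian_forest_green by (intro sum.cong) auto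
  also have "\<dots> = 1" using assms finite_V by (simp add: of_bool_def)
  finally show ?thesis .
qed

lemma conductance_at_pos:
  assumes "u \<in> V"
  shows "conductance_at u > 0"
proof -
  have "\<exists>w\<in>V. w \<noteq> u"
  proof (rule ccontr)
    assume "\<not> ?thesis"
    then have "V \<subseteq> {u}" by blast
    then have "card V \<le> 1" using card_mono[of "{u}" V] by simp
    then show False using card_V by simp
  qed
  then obtain w where w: "w \<in> V" "w \<noteq> u" by blast
  have "(u, w) \<in> (adjacency E)\<^sup>*"
    using connected assms w by (auto simp: connected_graph_def reachability_iff)
  then obtain y where "(u, y) \<in> adjacency E"
    using w(2) by (metis converse_rtranclE)
  then have "{u, y} \<in> E" by (simp add: adjacency_def)
  then have "y \<in> V" using edgeE[of "{u, y}"] by (metis doubleton_eq_iff)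
  with \<open>{u, y} \<in> E\<close> have "{v' \<in> V. {u, v'} \<in> E} \<noteq> {}" by blast
  then show ?thesis
    unfolding vertex_conductance_def using finite_V c_pos by (intro sum_pos) auto
qed

text \<open>
  The Dirichlet equation \<open>\<Delta> h = 1\<close>, divided by the conductance of \<open>u\<close>. The term of \<open>v = b\<close> drops
  out since \<open>h\<close> vanishes there.
\<close>

lemma mean_hitting_time_step:
  assumes u: "u \<in> V - {b}"
  shows "mean_hitting_time u =
    1 / conductance_at u + (\<Sum>v\<in>V - {b}. transition u v * mean_hitting_time v)"
proof -
  let ?N = "{v' \<in> V. {u, v'} \<in> E}"
  have pos: "conductance_at u > 0" using u by (intro conductance_at_pos) simp
  have "1 = conductance_at u * mean_hitting_time u -
      (\<Sum>v\<in>?N. c {u, v} * mean_hitting_time v)"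
    using laplacian_mean_hitting_time[OF u]
    by (simp add: laplacian_def vertex_conductance_def algebra_simps sum_subtractf sum_distrib_left)
  also have "(\<Sum>v\<in>?N. c {u, v} * mean_hitting_time v) =
      (\<Sum>v\<in>V. conductance_at u * (transition u v * mean_hitting_time v))"
    using finite_V pos by (intro sum.mono_neutral_cong_left) (auto simp: transition_prob_def)
  also have "\<dots> = conductance_at u * (\<Sum>v\<in>V. transition u v * mean_hitting_time v)"
    by (simp add: sum_distrib_left)
  also have "(\<Sum>v\<in>V. transition u v * mean_hitting_time v) =
      (\<Sum>v\<in>V - {b}. transition u v * mean_hitting_time v)"
    by (simp add: sum.remove[OF finite_V b_in] mean_hitting_time_b)
  finally show ?thesis using pos by (simp add: field_simps)
qed

end

locale network_walk = network V E c b + prob_space M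
  for V :: "'a set" and E :: "'a set set" and c :: "'a set \<Rightarrow> real" and b :: 'a
    and M :: "'w measure" +
  fixes X :: "nat \<Rightarrow> 'w \<Rightarrow> 'a" and H :: "nat \<Rightarrow> 'w \<Rightarrow> real"
  assumes walk: "conductance_walk V E c M X H"
begin

lemma X_measurable [measurable]: "X n \<in> M \<rightarrow>\<^sub>M count_space V"
  using walk by (simp add: conductance_walk_def)

lemma X_in: "\<omega> \<in> space M \<Longrightarrow> X n \<omega> \<in> V"
  using measurable_space[OF X_measurable] by simp

lemma H_exponential: "distributed M lborel (H n) (exponential_density 1)"
  using walk by (simp add: conductance_walk_def)

lemma H_measurable [measurable]: "H n \<in> borel_measurable M"
  using distributed_measurable[OF H_exponential] by simp

definition avoiding_paths :: "nat \<Rightarrow> (nat \<Rightarrow> 'a) set" where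
  "avoiding_paths k = (\<Pi>\<^sub>E i\<in>{..k}. V - {b})"

definition follows :: "nat \<Rightarrow> (nat \<Rightarrow> 'a) \<Rightarrow> 'w set" where
  "follows k x = {\<omega> \<in> space M. \<forall>i\<le>k. X i \<omega> = x i}"

text \<open>
  The expectation of \<open>g\<close> at the \<open>k\<close>-th vertex of the jump chain killed at \<open>b\<close>. As a sum over
  paths it can be computed from the probabilities of finite paths, by which the walk is given.
\<close>

definition killed_expectation :: "nat \<Rightarrow> ('a \<Rightarrow> real) \<Rightarrow> real" where
  "killed_expectation k g = (\<Sum>x\<in>avoiding_paths k. prob (follows k x) * g (x k))"

lemma finite_avoiding_paths: "finite (avoiding_paths k)"
  unfolding avoiding_paths_def using finite_V by (intro finite_PiE) auto

lemma avoiding_paths_iff: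
  "x \<in> avoiding_paths k \<longleftrightarrow> (\<forall>i\<le>k. x i \<in> V - {b}) \<and> (\<forall>i>k. x i = undefined)"
  by (auto simp: avoiding_paths_def PiE_iff extensional_def not_le)

lemma avoiding_paths_end: "x \<in> avoiding_paths k \<Longrightarrow> i \<le> k \<Longrightarrow> x i \<in> V - {b}"
  by (simp add: avoiding_paths_iff)

lemma prob_follows:
  assumes "x \<in> avoiding_paths k"
  shows "prob (follows k x) =
    (1 / real (card V)) * (\<Prod>i<k. transition (x i) (x (Suc i)))"
proof -
  have "\<forall>i\<le>k. x i \<in> V" using avoiding_paths_end[OF assms] by blast
  then show ?thesis using walk by (simp add: conductance_walk_def follows_def)
qed

lemma bij_betw_extend_path:
  "bij_betw (\<lambda>(x, v). x(Suc k := v)) (avoiding_paths k \<times> (V - {b})) (avoiding_paths (Suc k))"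
proof (rule bij_betw_byWitness[where f' = "\<lambda>y. (y(Suc k := undefined), y (Suc k))"])
  show "\<forall>p\<in>avoiding_paths k \<times> (V - {b}).
      (\<lambda>y. (y(Suc k := undefined), y (Suc k))) ((\<lambda>(x, v). x(Suc k := v)) p) = p"
    by (auto simp: avoiding_paths_iff fun_eq_iff)
qed (simp_all add: image_subset_iff avoiding_paths_iff le_Suc_eq)

lemma prob_follows_extend:
  assumes "x \<in> avoiding_paths k" "v \<in> V" "v \<noteq> b"
  shows "prob (follows (Suc k) (x(Suc k := v))) = prob (follows k x) * transition (x k) v"
proof -
  have "x(Suc k := v) \<in> avoiding_paths (Suc k)"
    using bij_betw_apply[OF bij_betw_extend_path, of "(x, v)" k] assms by simp
  from prob_follows[OF this] prob_follows[OF assms(1)] show ?thesis by simp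
qed

lemma killed_expectation_Suc:
  "killed_expectation (Suc k) g = killed_expectation k (\<lambda>u. \<Sum>v\<in>V - {b}. transition u v * g v)"
proof -
  have "killed_expectation (Suc k) g = (\<Sum>(x, v)\<in>avoiding_paths k \<times> (V - {b}).
      prob (follows (Suc k) (x(Suc k := v))) * g v)"
    unfolding killed_expectation_def
    by (subst sum.reindex_bij_betw[OF bij_betw_extend_path, symmetric]) (auto intro!: sum.cong)
  also have "\<dots> = (\<Sum>(x, v)\<in>avoiding_paths k \<times> (V - {b}).
      prob (follows k x) * transition (x k) v * g v)"
  proof (intro sum.cong refl)
    fix p assume "p \<in> avoiding_paths k \<times> (V - {b})"
    then obtain x v where "p = (x, v)" "x \<in> avoiding_paths k" "v \<in> V" "v \<noteq> b" by blast
    then show "(case p of (x, v) \<Rightarrow> prob (follows (Suc k) (x(Suc k := v))) * g v) =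
        (case p of (x, v) \<Rightarrow> prob (follows k x) * transition (x k) v * g v)"
      by (simp add: prob_follows_extend)
  qed
  also have "\<dots> = killed_expectation k (\<lambda>u. \<Sum>v\<in>V - {b}. transition u v * g v)"
    unfolding killed_expectation_def
    by (subst sum.cartesian_product[symmetric]) (simp add: sum_distrib_left mult.assoc)
  finally show ?thesis .
qed

lemma killed_expectation_0:
  "killed_expectation 0 g = (1 / real (card V)) * (\<Sum>v\<in>V - {b}. g v)"
proof -
  have "killed_expectation 0 g = (\<Sum>x\<in>avoiding_paths 0. (1 / real (card V)) * g (x 0))"
    unfolding killed_expectation_def using prob_follows by (intro sum.cong) auto
  also have "\<dots> = (\<Sum>v\<in>V - {b}. (1 / real (card V)) * g v)"
    by (rule sum.reindex_bij_witness[of _ "\<lambda>v i. if i = 0 then v else undefined" "\<lambda>x. x 0"])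
      (auto simp: avoiding_paths_def PiE_def extensional_def fun_eq_iff)
  finally show ?thesis by (simp add: sum_distrib_left)
qed

lemma killed_expectation_add:
  "killed_expectation k (\<lambda>u. f u + g u) = killed_expectation k f + killed_expectation k g"
  by (simp add: killed_expectation_def distrib_left sum.distrib)

lemma killed_expectation_cong:
  "(\<And>u. u \<in> V - {b} \<Longrightarrow> f u = g u) \<Longrightarrow> killed_expectation k f = killed_expectation k g"
  unfolding killed_expectation_def using avoiding_paths_end by (intro sum.cong) auto

lemma killed_expectation_mono:
  "(\<And>u. u \<in> V - {b} \<Longrightarrow> f u \<le> g u) \<Longrightarrow> killed_expectation k f \<le> killed_expectation k g"
  unfolding killed_expectation_def using avoiding_paths_end
  by (intro sum_mono mult_left_mono) auto

lemma killed_expectation_nonneg: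
  "(\<And>u. u \<in> V - {b} \<Longrightarrow> g u \<ge> 0) \<Longrightarrow> killed_expectation k g \<ge> 0"
  unfolding killed_expectation_def using avoiding_paths_end
  by (intro sum_nonneg mult_nonneg_nonneg) auto

lemma killed_expectation_mult: "killed_expectation k (\<lambda>u. a * g u) = a * killed_expectation k g"
  by (simp add: killed_expectation_def sum_distrib_left mult_ac)

abbreviation "holding \<equiv> \<lambda>u. 1 / conductance_at u"


lemma sum_killed_holding:
  "(\<Sum>k<n. killed_expectation k holding) =
     killed_expectation 0 mean_hitting_time - killed_expectation n mean_hitting_time"
proof (induction n)
  case (Suc n)
  have "killed_expectation n mean_hitting_time =
      killed_expectation n (\<lambda>u. holding u + (\<Sum>v\<in>V - {b}. transition u v * mean_hitting_time v))"
    by (intro killed_expectation_cong mean_hitting_time_step)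
  also have "\<dots> = killed_expectation n holding + killed_expectation (Suc n) mean_hitting_time"
    by (simp add: killed_expectation_add killed_expectation_Suc)
  finally show ?case using Suc by simp
qed simp

lemma killed_holding_nonneg: "killed_expectation k holding \<ge> 0"
  using conductance_at_pos by (intro killed_expectation_nonneg) (auto intro: less_imp_le)

text \<open>
  The expected holding times form a convergent series, since their partial sums are bounded by
  the telescoped value; so they tend to \<open>0\<close>, and with them everything they dominate. In
  particular the survival probability tends to \<open>0\<close>.
\<close>

lemma killed_expectation_tendsto_0:
  assumes g: "\<And>u. u \<in> V - {b} \<Longrightarrow> g u \<ge> 0"
  shows "(\<lambda>k. killed_expectation k g) \<longlonglongrightarrow> 0"
proof -
  have "summable (\<lambda>k. killed_expectation k holding)"
    using sum_killed_holding killed_holding_nonneg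
      killed_expectation_nonneg[OF mean_hitting_time_nonneg]
    by (intro summableI_nonneg_bounded[of _ "killed_expectation 0 mean_hitting_time"]) auto
  then have lim: "(\<lambda>k. killed_expectation k holding) \<longlonglongrightarrow> 0" by (rule summable_LIMSEQ_zero)
  \<comment> \<open>Every function on the finite set of vertices is dominated by a multiple of the holding time.\<close>
  define K where "K = (\<Sum>u\<in>V - {b}. g u * conductance_at u)"
  have "g u \<le> K * holding u" if "u \<in> V - {b}" for u
  proof -
    have pos: "conductance_at u > 0" using that conductance_at_pos by simp
    have "g u * conductance_at u \<le> K"
      unfolding K_def using that finite_V g conductance_at_pos
      by (intro member_le_sum) (auto intro!: mult_nonneg_nonneg intro: less_imp_le)
    with pos show ?thesis by (simp add: field_simps)
  qed
  then have le: "killed_expectation k g \<le> K * killed_expectation k holding" for k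
    unfolding killed_expectation_mult[symmetric] by (intro killed_expectation_mono)
  show ?thesis
    by (rule tendsto_sandwich[OF _ _ tendsto_const[of 0] tendsto_mult_right_zero[OF lim, of K]])
      (auto intro!: always_eventually killed_expectation_nonneg g le)
qed

lemma killed_holding_sums:
  "(\<lambda>k. killed_expectation k holding) sums
     ((1 / real (card V)) * (\<Sum>u\<in>V. mean_hitting_time u))"
proof -
  have "killed_expectation 0 mean_hitting_time = (1 / real (card V)) * (\<Sum>u\<in>V. mean_hitting_time u)"
    by (simp add: killed_expectation_0 sum.remove[OF finite_V b_in] mean_hitting_time_b)
  moreover have "(\<lambda>n. killed_expectation 0 mean_hitting_time - killed_expectation n mean_hitting_time)
      \<longlonglongrightarrow> killed_expectation 0 mean_hitting_time - 0"
    by (intro tendsto_diff tendsto_const killed_expectation_tendsto_0 mean_hitting_time_nonneg)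
  ultimately show ?thesis
    unfolding sums_def sum_killed_holding by simp
qed

lemma follows_sets [measurable]: "x \<in> avoiding_paths k \<Longrightarrow> follows k x \<in> sets M"
proof -
  assume x: "x \<in> avoiding_paths k"
  have "follows k x = (\<Inter>i\<in>{..k}. X i -` {x i} \<inter> space M)"
    by (auto simp: follows_def)
  also have "\<dots> \<in> sets M"
    using avoiding_paths_end[OF x] by (intro sets.finite_INT measurable_sets[OF X_measurable]) auto
  finally show ?thesis .
qed

text \<open>
  The event of following \<open>x\<close> is determined by the jump chain, hence independent of the clock
  \<open>H k\<close>, which has mean one.
\<close>

lemma expectation_follows_holding:
  assumes x: "x \<in> avoiding_paths k"
  shows "integrable M (\<lambda>\<omega>. indicator (follows k x) \<omega> * H k \<omega>)"
    and "expectation (\<lambda>\<omega>. indicator (follows k x) \<omega> * H k \<omega>) = prob (follows k x)"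
proof -
  \<comment> \<open>As a product of coordinate functions, the indicator is visibly measurable with respect to
    the sigma-algebra generated by the chain.\<close>
  let ?f = "\<lambda>\<xi>. \<Prod>i\<le>k. indicator {x i} (\<xi> i) :: real"
  let ?X = "vimage_algebra (space M) (\<lambda>\<omega> n. X n \<omega>) (\<Pi>\<^sub>M n\<in>UNIV. count_space V)"
  let ?H = "vimage_algebra (space M) (\<lambda>\<omega> n. H n \<omega>) (\<Pi>\<^sub>M n\<in>UNIV. borel)"
  have "(\<lambda>\<omega> n. X n \<omega>) \<in> ?X \<rightarrow>\<^sub>M (\<Pi>\<^sub>M n\<in>UNIV. count_space V)"
    by (rule measurable_vimage_algebra1) (auto simp: space_PiM X_in)
  moreover have "?f \<in> borel_measurable (\<Pi>\<^sub>M n\<in>UNIV. count_space V)"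
    by (intro borel_measurable_prod measurable_compose[OF measurable_component_singleton]) auto
  ultimately have X: "(\<lambda>\<omega>. ?f (\<lambda>n. X n \<omega>)) \<in> borel_measurable ?X"
    by (rule measurable_compose)
  have "(\<lambda>\<omega> n. H n \<omega>) \<in> ?H \<rightarrow>\<^sub>M (\<Pi>\<^sub>M n\<in>UNIV. borel)"
    by (rule measurable_vimage_algebra1) (auto simp: space_PiM)
  from measurable_compose[OF this measurable_component_singleton[of k UNIV]]
  have H: "H k \<in> borel_measurable ?H" by simp
  have sub: "sigma_sets (space M) {f -` A \<inter> space M |A. A \<in> sets borel} \<subseteq> sets N"
    if "f \<in> borel_measurable N" "space N = space M" for f :: "'w \<Rightarrow> real" and N :: "'w measure"
  proof -
    have "{f -` A \<inter> space M |A. A \<in> sets borel} \<subseteq> sets N"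
      using measurable_sets[OF that(1)] that(2) by auto
    from sets.sigma_sets_subset[OF this] show ?thesis using that(2) by simp
  qed
  have "indep_set (sets ?X) (sets ?H)"
    using walk by (simp add: conductance_walk_def)
  then have "indep_set (sigma_sets (space M) {(\<lambda>\<omega>. ?f (\<lambda>n. X n \<omega>)) -` A \<inter> space M |A. A \<in> sets borel})
      (sigma_sets (space M) {H k -` A \<inter> space M |A. A \<in> sets borel})"
    unfolding indep_set_def
    by (rule indep_sets_mono_sets) (use sub[OF X] sub[OF H] in \<open>auto split: bool.split\<close>)
  moreover have "(\<lambda>\<omega>. ?f (\<lambda>n. X n \<omega>)) \<in> borel_measurable M"
    by (intro borel_measurable_prod measurable_compose[OF X_measurable]) auto
  ultimately have indep: "indep_var borel (\<lambda>\<omega>. ?f (\<lambda>n. X n \<omega>)) borel (H k)"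
    unfolding indep_var_eq by simp
  have f: "?f (\<lambda>n. X n \<omega>) = indicator (follows k x) \<omega>" if "\<omega> \<in> space M" for \<omega>
    using that by (auto simp: follows_def indicator_def prod.If_cases)
  have int_f: "integrable M (\<lambda>\<omega>. ?f (\<lambda>n. X n \<omega>))"
    using follows_sets[OF x] by (subst Bochner_Integration.integrable_cong[OF refl f])
      (auto intro!: integrable_real_indicator simp: less_top[symmetric])
  have int_H: "integrable M (H k)"
    using erlang_ith_moment_integrable[OF zero_less_one H_exponential[of k], of 1] by simp
  have "integrable M (\<lambda>\<omega>. ?f (\<lambda>n. X n \<omega>) * H k \<omega>)"
    by (rule indep_var_integrable[OF indep int_f int_H])
  then show "integrable M (\<lambda>\<omega>. indicator (follows k x) \<omega> * H k \<omega>)"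
    by (rule Bochner_Integration.integrable_cong[OF refl, THEN iffD1, rotated]) (simp add: f)
  have "expectation (\<lambda>\<omega>. indicator (follows k x) \<omega> * H k \<omega>) =
      expectation (\<lambda>\<omega>. ?f (\<lambda>n. X n \<omega>) * H k \<omega>)"
    by (intro Bochner_Integration.integral_cong refl) (simp add: f)
  also have "\<dots> = expectation (\<lambda>\<omega>. ?f (\<lambda>n. X n \<omega>)) * expectation (H k)"
    by (rule indep_var_lebesgue_integral[OF indep int_f int_H])
  also have "expectation (\<lambda>\<omega>. ?f (\<lambda>n. X n \<omega>)) = expectation (indicator (follows k x))"
    by (intro Bochner_Integration.integral_cong refl f)
  also have "expectation (H k) = 1"
    using exponential_distributed_expectation[OF zero_less_one H_exponential] by simp
  finally show "expectation (\<lambda>\<omega>. indicator (follows k x) \<omega> * H k \<omega>) = prob (follows k x)"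
    using follows_sets[OF x] by simp
qed

lemma AE_H_pos: "AE \<omega> in M. \<forall>n. H n \<omega> > 0"
proof -
  have "AE \<omega> in M. H n \<omega> > 0" for n
  proof -
    have "prob {\<omega> \<in> space M. 0 < H n \<omega>} = 1"
      using exponential_distributedD_gt[OF H_exponential, of 0] by simp
    then have "AE \<omega> in M. \<omega> \<in> {\<omega> \<in> space M. 0 < H n \<omega>}" by (rule AE_prob_1)
    then show ?thesis by eventually_elim simp
  qed
  then show ?thesis by (simp add: AE_all_countable)
qed

definition killed_time :: "nat \<Rightarrow> 'w \<Rightarrow> real" where
  "killed_time k \<omega> = (if \<forall>i\<le>k. X i \<omega> \<noteq> b then H k \<omega> / conductance_at (X k \<omega>) else 0)"

lemma sum_indicator_follows:
  assumes "\<omega> \<in> space M"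
  shows "(\<Sum>x\<in>avoiding_paths k. indicator (follows k x) \<omega> * g (x k)) =
    (if \<forall>i\<le>k. X i \<omega> \<noteq> b then g (X k \<omega>) else (0 :: real))"
proof -
  let ?x = "\<lambda>i. if i \<le> k then X i \<omega> else undefined"
  have "\<omega> \<in> follows k x \<longleftrightarrow> x = ?x" if "x \<in> avoiding_paths k" for x
    using that assms
    by (auto simp: follows_def avoiding_paths_def PiE_def extensional_def fun_eq_iff)
  then have "(\<Sum>x\<in>avoiding_paths k. indicator (follows k x) \<omega> * g (x k)) =
      (\<Sum>x\<in>avoiding_paths k. if x = ?x then g (X k \<omega>) else 0)"
    by (intro sum.cong refl) (auto simp: indicator_def)
  also have "\<dots> = (if ?x \<in> avoiding_paths k then g (X k \<omega>) else 0)"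
    using finite_avoiding_paths by simp
  also have "?x \<in> avoiding_paths k \<longleftrightarrow> (\<forall>i\<le>k. X i \<omega> \<noteq> b)"
    using X_in[OF assms] by (auto simp: avoiding_paths_def PiE_def extensional_def)
  finally show ?thesis .
qed

lemma expectation_killed_time:
  "integrable M (killed_time k)" "expectation (killed_time k) = killed_expectation k holding"
proof -
  have eq: "killed_time k \<omega> =
      (\<Sum>x\<in>avoiding_paths k. holding (x k) * (indicator (follows k x) \<omega> * H k \<omega>))"
    if "\<omega> \<in> space M" for \<omega>
    using sum_indicator_follows[OF that, of k "\<lambda>u. H k \<omega> / conductance_at u"]
    by (simp add: killed_time_def mult_ac)
  show "integrable M (killed_time k)"
    by (subst Bochner_Integration.integrable_cong[OF refl eq])
      (auto intro!: Bochner_Integration.integrable_sum integrable_mult_right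
         expectation_follows_holding(1))
  have "expectation (killed_time k) = expectation (\<lambda>\<omega>.
      \<Sum>x\<in>avoiding_paths k. holding (x k) * (indicator (follows k x) \<omega> * H k \<omega>))"
    by (intro Bochner_Integration.integral_cong refl eq)
  also have "\<dots> = (\<Sum>x\<in>avoiding_paths k. holding (x k) * prob (follows k x))"
    by (subst Bochner_Integration.integral_sum)
      (auto intro!: sum.cong integrable_mult_right simp: expectation_follows_holding)
  finally show "expectation (killed_time k) = killed_expectation k holding"
    by (simp add: killed_expectation_def mult.commute)
qed

lemma killed_time_nonneg:
  "\<omega> \<in> space M \<Longrightarrow> H k \<omega> > 0 \<Longrightarrow> killed_time k \<omega> \<ge> 0"
  using conductance_at_pos[OF X_in, of \<omega> k] by (simp add: killed_time_def)

lemma nn_integral_killed_time: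
  "(\<integral>\<^sup>+ \<omega>. ennreal (killed_time k \<omega>) \<partial>M) = ennreal (killed_expectation k holding)"
proof -
  have "AE \<omega> in M. 0 \<le> killed_time k \<omega>"
    using AE_H_pos AE_space by eventually_elim (auto intro: killed_time_nonneg)
  then show ?thesis
    using expectation_killed_time[of k] by (simp add: nn_integral_eq_integral)
qed

text \<open>The event of avoiding \<open>b\<close> for ever is contained in survival up to any step \<open>k\<close>.\<close>

lemma AE_hits: "AE \<omega> in M. \<exists>n. X n \<omega> = b"
proof -
  let ?A = "\<lambda>k. {\<omega> \<in> space M. \<forall>i\<le>k. X i \<omega> \<noteq> b}"
  have A_eq: "?A k = (\<Union>x\<in>avoiding_paths k. follows k x)" for k
  proof -
    have "\<omega> \<in> ?A k \<longleftrightarrow> \<omega> \<in> (\<Union>x\<in>avoiding_paths k. follows k x)" if "\<omega> \<in> space M" for \<omega>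
    proof -
      have "(\<Sum>x\<in>avoiding_paths k. indicator (follows k x) \<omega>) \<noteq> (0 :: real) \<longleftrightarrow>
          (\<exists>x\<in>avoiding_paths k. \<omega> \<in> follows k x)"
        by (subst sum_nonneg_eq_0_iff[OF finite_avoiding_paths]) (auto simp: indicator_def)
      with sum_indicator_follows[OF that, of k "\<lambda>_. 1"] that show ?thesis
        by (simp split: if_splits)
    qed
    then show ?thesis by (auto simp: follows_def)
  qed
  have sets: "?A k \<in> sets M" for k
    unfolding A_eq using finite_avoiding_paths by (intro sets.finite_UN follows_sets)
  have le: "prob (?A k) \<le> killed_expectation k (\<lambda>_. 1)" for k
    unfolding A_eq killed_expectation_def mult_1_right
    by (intro finite_measure_subadditive_finite finite_avoiding_paths) (auto intro: follows_sets)
  let ?B = "\<Inter>k. ?A k"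
  have "prob ?B \<le> killed_expectation k (\<lambda>_. 1)" for k
    using finite_measure_mono[of ?B "?A k"] le[of k] sets by force
  then have "prob ?B \<le> 0"
    using killed_expectation_tendsto_0[of "\<lambda>_. 1"] by (intro LIMSEQ_le_const) auto
  then have "prob ?B = 0" by (simp add: measure_le_0_iff)
  moreover have "?B \<in> sets M" using sets by blast
  ultimately have "AE \<omega> in M. \<omega> \<notin> ?B" by (simp add: prob_eq_0)
  with AE_space show ?thesis by eventually_elim auto
qed

text \<open>
  The holding times are nonnegative, so that the least arrival time at \<open>b\<close> is that of the first
  visit, whose index is \<open>n\<close>; the terms of the series vanish from there on.
\<close>

lemma hitting_time_eq_suminf:
  assumes \<omega>: "\<omega> \<in> space M" and H: "\<And>k. H k \<omega> > 0" and hit: "\<exists>n. X n \<omega> = b"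
  shows "hitting_time V E c b X H \<omega> = (\<Sum>k. ennreal (killed_time k \<omega>))"
proof -
  define n where "n = (LEAST n. X n \<omega> = b)"
  have n: "X n \<omega> = b" unfolding n_def using hit by (rule LeastI_ex)
  have least: "n \<le> m" if "X m \<omega> = b" for m unfolding n_def using that by (rule Least_le)
  let ?t = "\<lambda>k. H k \<omega> / conductance_at (X k \<omega>)"
  have t: "?t k \<ge> 0" for k
    using H[of k] conductance_at_pos[OF X_in[OF \<omega>], of k] by simp
  have "hitting_time V E c b X H \<omega> = ennreal (\<Sum>k<n. ?t k)"
    unfolding hitting_time_def
  proof (rule antisym)
    show "(INF m\<in>{m. X m \<omega> = b}. ennreal (\<Sum>k<m. ?t k)) \<le> ennreal (\<Sum>k<n. ?t k)"
      using n by (intro INF_lower) simp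
    show "ennreal (\<Sum>k<n. ?t k) \<le> (INF m\<in>{m. X m \<omega> = b}. ennreal (\<Sum>k<m. ?t k))"
      using least t by (intro INF_greatest ennreal_leI sum_mono2) auto
  qed
  also have "(\<Sum>k<n. ?t k) = (\<Sum>k<n. killed_time k \<omega>)"
  proof (intro sum.cong refl)
    fix k assume "k \<in> {..<n}"
    then have "\<forall>i\<le>k. X i \<omega> \<noteq> b" using least by force
    then show "?t k = killed_time k \<omega>" by (simp add: killed_time_def)
  qed
  also have "ennreal \<dots> = (\<Sum>k<n. ennreal (killed_time k \<omega>))"
    using killed_time_nonneg[OF \<omega> H] by (intro sum_ennreal[symmetric])
  also have "\<dots> = (\<Sum>k. ennreal (killed_time k \<omega>))"
    using n by (intro suminf_finite[symmetric]) (auto simp: killed_time_def not_less)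
  finally show ?thesis .
qed

lemma nn_integral_hitting_time:
  "(\<integral>\<^sup>+ \<omega>. hitting_time V E c b X H \<omega> \<partial>M) =
     ennreal ((1 / real (card V)) * (\<Sum>u\<in>V. mean_hitting_time u))"
proof -
  have "AE \<omega> in M. hitting_time V E c b X H \<omega> = (\<Sum>k. ennreal (killed_time k \<omega>))"
    using AE_hits AE_H_pos AE_space
    by eventually_elim (rule hitting_time_eq_suminf; blast)
  then have "(\<integral>\<^sup>+ \<omega>. hitting_time V E c b X H \<omega> \<partial>M) =
      (\<integral>\<^sup>+ \<omega>. (\<Sum>k. ennreal (killed_time k \<omega>)) \<partial>M)"
    by (rule nn_integral_cong_AE)
  also have "\<dots> = (\<Sum>k. \<integral>\<^sup>+ \<omega>. ennreal (killed_time k \<omega>) \<partial>M)"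
    using borel_measurable_integrable[OF expectation_killed_time(1)]
    by (intro nn_integral_suminf) auto
  also have "\<dots> = (\<Sum>k. ennreal (killed_expectation k holding))"
    by (simp add: nn_integral_killed_time)
  also have "\<dots> = ennreal ((1 / real (card V)) * (\<Sum>u\<in>V. mean_hitting_time u))"
    by (rule suminf_ennreal_eq[OF killed_holding_nonneg killed_holding_sums])
  finally show ?thesis .
qed

end

theorem theorem5:
  fixes V :: "'a set" and E :: "'a set set" and c :: "'a set \<Rightarrow> real" and b :: 'a
  assumes "finite V" and "simple_graph V E" and "connected_graph V E"
    and "\<forall>e\<in>E. c e > 0" and "b \<in> V" and "card V \<ge> 2"
  shows "let P = two_forest_pmf V E c;
             Sig = floating_component V b;
             G = green V E c b;
             N = real (card V);
             lstar = measure_pmf.expectation P (\<lambda>B. boundary_size E c (Sig B));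
             R = (\<Sum>v\<in>V. G v v) / N;
             tau = (1 / N) * (\<Sum>u\<in>V. \<Sum>v\<in>V. G u v)
         in measure_pmf.expectation P (\<lambda>B. real (card (Sig B))) = lstar * (N / (N - 1)) * R
          \<and> measure_pmf.expectation P (\<lambda>B. (real (card (Sig B)))\<^sup>2) = lstar * (N / (N - 1)) * tau
          \<and> R = (\<Sum>v\<in>V. resistance V E c v b) / N
          \<and> (\<forall>(M :: 'w measure) X H. conductance_walk V E c M X H \<longrightarrow>
               (\<integral>\<^sup>+ \<omega>. hitting_time V E c b X H \<omega> \<partial>M) = ennreal tau)"
proof -
  interpret network V E c b using assms by unfold_locales auto
  have N: "real (card V) - 1 \<noteq> 0" "real (card V) \<noteq> 0" using card_V by auto
  \<comment> \<open>The factor \<open>\<ell>\<^sup>* / (|V| - 1)\<close> is \<open>\<kappa> / \<kappa>\<^sub>2\<close>, which converts the normalisation by trees into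
    the one by forests.\<close>
  have moment: "a / forest_sum = tree_sum * (real (card V) - 1) / forest_sum *
      (real (card V) / (real (card V) - 1)) * t"
    if "t = a / tree_sum / real (card V)" for a t
    using N tree_sum_pos forest_sum_pos unfolding that by (simp add: divide_simps)
  have walk: "(\<integral>\<^sup>+ \<omega>. hitting_time V E c b X H \<omega> \<partial>M) =
      ennreal ((1 / real (card V)) * (\<Sum>u\<in>V. \<Sum>v\<in>V. green V E c b u v))"
    if "conductance_walk V E c M X H" for M :: "'w measure" and X H
  proof -
    interpret prob_space M using that by (simp add: conductance_walk_def)
    interpret network_walk V E c b M X H using that by unfold_locales
    show ?thesis using nn_integral_hitting_time by (simp add: mean_hitting_time_def)
  qed
  show ?thesis
    unfolding Let_def expectation_boundary_size expectation_two_forest_pmf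
  proof (intro conjI allI impI walk)
    show "(\<Sum>v\<in>V. green V E c b v v) / real (card V) = (\<Sum>v\<in>V. resistance V E c v b) / real (card V)"
      by (simp add: resistance_eq_green)
  qed (rule moment, simp add: sum_green sum_green_diagonal)+
qed

end
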